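(* Three different optimally dense admissible horoball arrangements $\mathcal{B}_{344}^i$ $(i=1,2,3)$ (described in the context) exist for the octahedral Coxeter tiling $(3,4,4)$, which share the optimum density $\delta(\mathcal{B}_{344}^i)\approx 0.818808$. Here optimally dense means that the arrangement has the maximal density $\delta$ among all admissible horoball arrangements in the cell $P_{344}$.
   Context: $\mathbb{H}^3$ is hyperbolic 3-space of curvature $-1$. The Coxeter tiling $(3,4,4)$ is the regular face-to-face tiling of $\mathbb{H}^3$ by congruent regular ideal octahedra $P_{344}$ (all 6 vertices on $\partial\mathbb{H}^3$, dihedral angle $\pi/2$). The vertices of $P_{344}$ are $E_0,\dots,E_5$, where $E_3$ and $E_5$ are opposite and $E_0,E_1,E_2,E_4$ are the four vertices adjacent to both. An admissible horoball arrangement $\mathcal{B}_{344}$ in $P_{344}$ consists of one horoball $B_i$ centered at each vertex $E_i$ such that (i) the horoballs have pairwise disjoint interiors (tangency is allowed), and (ii) the interior of $B_i$ does not meet any face of $P_{344}$ not incident with $E_i$. Its density is $$\delta(\mathcal{B}_{344})=\frac{\sum_{i} \mathrm{Vol}(B_i\cap P_{344})}{\mathrm{Vol}(P_{344})}.$$ Two horoballs centered at vertices of the cell are of the same type if a symmetry of the cell carries one to the other. The "midpoint" of an edge is the foot of the perpendicular from the center of the cell to that edge. The arrangements: $\mathcal{B}_{344}^1$: all six horoballs are of the same type and horoballs at adjacent vertices are tangent at the midpoints of the edges. $\mathcal{B}_{344}^2$: the two larger horoballs $B_3,B_5$ are tangent to each other at the center of the octahedron, and each of the horoballs $B_0,B_1,B_2,B_4$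 is tangent to both larger horoballs. $\mathcal{B}_{344}^3$: the horoball $B_3$ is tangent to all faces of the octahedron not incident with $E_3$, and each of the other five horoballs is tangent to $B_3$. *)

theory Defs
  imports "HOL-Analysis.Analysis"
begin

text \<open>
  Hyperbolic 3-space of curvature -1 in the projective (Beltrami--Cayley--Klein) model: the open
  unit ball, whose boundary points are the points of the unit sphere. Geodesics, planes and
  polyhedra are the Euclidean segments, affine planes and polytopes, intersected with the ball.
\<close>

definition hyp_space :: "(real ^ 3) set" where
  "hyp_space = ball 0 1"

definition hyp_dist :: "real ^ 3 \<Rightarrow> real ^ 3 \<Rightarrow> real" where
  "hyp_dist x y = arcosh ((1 - x \<bullet> y) / sqrt ((1 - x \<bullet> x) * (1 - y \<bullet> y)))"

definition hyp_metric :: "real ^ 3 \<Rightarrow> real ^ 3 \<Rightarrow> real ^ 3 \<Rightarrow> real" where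
  "hyp_metric p v w = (v \<bullet> w) / (1 - p \<bullet> p) + (p \<bullet> v) * (p \<bullet> w) / (1 - p \<bullet> p)\<^sup>2"

text \<open>
  The Riemannian volume element of the model is \<open>1 / (1 - |x|\<^sup>2)\<^sup>2\<close>, the square root of the Gram
  determinant of the metric tensor; see the lemma \<open>hyp_volume_element\<close> below.
\<close>

definition hyp_measure :: "(real ^ 3) measure" where
  "hyp_measure = density lborel (\<lambda>x. ennreal (indicator hyp_space x / (1 - x \<bullet> x)\<^sup>2))"

definition hyp_vol :: "(real ^ 3) set \<Rightarrow> real" where
  "hyp_vol A = measure hyp_measure A"

lemma hyp_volume_element:
  assumes "x \<in> hyp_space"
  shows "sqrt (det (\<chi> i j. hyp_metric x (axis i 1) (axis j 1)) :: real) = 1 / (1 - x \<bullet> x)\<^sup>2"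
proof -
  define a where "a = 1 - x \<bullet> x"
  have a: "a > 0"
    using assms by (simp add: a_def hyp_space_def dot_square_norm abs_square_less_1)
  have xx: "(x$1)\<^sup>2 + (x$2)\<^sup>2 + (x$3)\<^sup>2 = 1 - a"
    by (simp add: a_def inner_vec_def sum_3 power2_eq_square)
  have m: "hyp_metric x (axis i 1) (axis j 1) = (if i = j then 1 else 0) / a + x$i * x$j / a\<^sup>2"
    for i j
  proof -
    have "(axis i 1 :: real ^ 3) \<bullet> axis j 1 = (if i = j then 1 else 0)"
      by (simp add: inner_axis_axis)
    then show ?thesis by (simp only: hyp_metric_def a_def inner_axis inner_real_def mult_1_right)
  qed
  have "det (\<chi> i j. hyp_metric x (axis i 1) (axis j 1)) =
        1 / a ^ 3 + ((x$1)\<^sup>2 + (x$2)\<^sup>2 + (x$3)\<^sup>2) / a ^ 4"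
    using a by (simp add: det_3 m) (simp add: field_simps power2_eq_square eval_nat_numeral)
  also have "\<dots> = (1 / a\<^sup>2)\<^sup>2"
    using a unfolding xx by (simp add: field_simps power2_eq_square eval_nat_numeral)
  finally show ?thesis
    using a by (simp add: a_def)
qed

definition hyp_isometry :: "(real ^ 3 \<Rightarrow> real ^ 3) \<Rightarrow> bool" where
  "hyp_isometry f \<longleftrightarrow> bij_betw f hyp_space hyp_space \<and>
     (\<forall>x\<in>hyp_space. \<forall>y\<in>hyp_space. hyp_dist (f x) (f y) = hyp_dist x y)"


text \<open>
  The Busemann function of the ideal point \<open>u\<close>, normalized to vanish at the origin; the horoballs
  centered at \<open>u\<close> are its closed sublevel sets.
\<close>

definition busemann :: "real ^ 3 \<Rightarrow> real ^ 3 \<Rightarrow> real" where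
  "busemann u x = Lim (at_left 1) (\<lambda>t. hyp_dist x (t *\<^sub>R u) - hyp_dist 0 (t *\<^sub>R u))"

definition is_horoball :: "real ^ 3 \<Rightarrow> (real ^ 3) set \<Rightarrow> bool" where
  "is_horoball u B \<longleftrightarrow> (\<exists>c. B = {x \<in> hyp_space. busemann u x \<le> c})"

lemma busemann_limit:
  assumes u: "norm u = 1" and x: "x \<in> hyp_space"
  shows "((\<lambda>t. hyp_dist x (t *\<^sub>R u) - hyp_dist 0 (t *\<^sub>R u)) \<longlongrightarrow>
           ln ((1 - x \<bullet> u) / sqrt (1 - x \<bullet> x))) (at_left 1)"
proof -
  define a where "a = 1 - x \<bullet> x"
  have a: "a > 0"
    using x by (simp add: a_def hyp_space_def dot_square_norm abs_square_less_1)
  have nx: "norm x < 1" using x by (simp add: hyp_space_def)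
  have xu: "\<bar>x \<bullet> u\<bar> < 1"
    using Cauchy_Schwarz_ineq2[of x u] u nx by simp
  have uu: "u \<bullet> u = 1" using u by (simp add: dot_square_norm)
  define N where "N t = (1 - t * (x \<bullet> u)) / sqrt a +
      sqrt ((1 - t * (x \<bullet> u))\<^sup>2 / a - (1 - t\<^sup>2))" for t :: real
  have "((\<lambda>t. ln (N t / (1 + t))) \<longlongrightarrow> ln (N 1 / (1 + 1))) (at_left 1)"
  proof (intro tendsto_ln tendsto_divide)
    show "(N \<longlongrightarrow> N 1) (at_left 1)"
      unfolding N_def by (intro tendsto_intros) (use a in auto)
    have "N 1 > 0" unfolding N_def using a xu
      by (intro add_pos_nonneg divide_pos_pos) auto
    then show "N 1 / (1 + 1) \<noteq> 0" by simp
    show "((\<lambda>t. 1 + t) \<longlongrightarrow> 1 + 1) (at_left (1::real))"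
      by (intro tendsto_intros)
  qed auto
  moreover have "N 1 / (1 + 1) = (1 - x \<bullet> u) / sqrt a"
  proof -
    have "N 1 = 2 * ((1 - x \<bullet> u) / sqrt a)"
      unfolding N_def using xu by (simp add: real_sqrt_divide)
    then show ?thesis by (simp only: one_add_one nonzero_mult_div_cancel_left[OF zero_neq_numeral[symmetric]])
  qed
  moreover have "eventually (\<lambda>t. hyp_dist x (t *\<^sub>R u) - hyp_dist 0 (t *\<^sub>R u) =
                   ln (N t / (1 + t))) (at_left 1)"
  proof -
    have "eventually (\<lambda>t. t \<in> {0<..<1::real}) (at_left 1)"
      by (rule eventually_at_leftI) auto
    then show ?thesis
    proof eventually_elim
      case (elim t)
      define s where "s = sqrt (1 - t\<^sup>2)"
      have t2: "1 - t\<^sup>2 > 0" using elim by (simp add: abs_square_less_1)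
      then have s: "s > 0" "s\<^sup>2 = 1 - t\<^sup>2" by (auto simp: s_def)
      have txu: "1 - t * (x \<bullet> u) > 0"
        using elim xu mult_left_le_one_le[of "\<bar>x \<bullet> u\<bar>" t] abs_mult[of t "x \<bullet> u"] by auto
      define b where "b = (1 - t * (x \<bullet> u)) / (sqrt a * s)"
      have sa: "sqrt a > 0" using a by simp
      have CS: "a * s\<^sup>2 \<le> (1 - t * (x \<bullet> u))\<^sup>2"
      proof -
        define n where "n = norm x"
        have "t * (x \<bullet> u) \<le> t * n"
          using Cauchy_Schwarz_ineq2[of x u] u elim by (intro mult_left_mono) (auto simp: n_def)
        moreover have "t * n \<le> 1"
          using elim nx by (intro mult_le_one) (auto simp: n_def)
        ultimately have "(1 - t * n)\<^sup>2 \<le> (1 - t * (x \<bullet> u))\<^sup>2"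
          by (intro power_mono) auto
        moreover have "(1 - t * n)\<^sup>2 - a * s\<^sup>2 = (n - t)\<^sup>2"
          unfolding s(2) a_def n_def dot_square_norm by (simp add: power2_eq_square algebra_simps)
        ultimately show ?thesis
          using zero_le_power2[of "n - t"] by linarith
      qed
      have b2: "b\<^sup>2 - 1 = ((1 - t * (x \<bullet> u))\<^sup>2 / a - (1 - t\<^sup>2)) / s\<^sup>2"
        unfolding s(2)[symmetric] b_def using s(1) a
        by (simp add: power_divide power_mult_distrib divide_simps)
      have "b\<^sup>2 \<ge> 1"
        using CS s(1) a by (simp add: b_def power_divide power_mult_distrib)
      moreover have "b > 0" using txu sa s(1) by (simp add: b_def)
      ultimately have b1: "b \<ge> 1"
        using power2_le_imp_le[of 1 b] by simp
      have sb: "s * (b + sqrt (b\<^sup>2 - 1)) = N t"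
        unfolding b2 using s(1) sa
        by (simp add: N_def b_def real_sqrt_divide distrib_left)
      have "s \<le> 1" unfolding s_def by (simp add: real_sqrt_le_1_iff)
      then have c1: "1 / s \<ge> 1" using s(1) by simp
      have "(1 / s)\<^sup>2 - 1 = (t / s)\<^sup>2"
        using s(1) t2 unfolding power_divide s(2) by (simp add: divide_simps)
      then have sc: "s * (1 / s + sqrt ((1 / s)\<^sup>2 - 1)) = 1 + t"
        using s(1) elim by (simp add: distrib_left)
      have "hyp_dist x (t *\<^sub>R u) = arcosh b"
        unfolding hyp_dist_def b_def s_def a_def using uu
        by (simp add: real_sqrt_mult power2_eq_square)
      moreover have "hyp_dist 0 (t *\<^sub>R u) = arcosh (1 / s)"
        unfolding hyp_dist_def s_def using uu by (simp add: power2_eq_square)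
      ultimately have "hyp_dist x (t *\<^sub>R u) - hyp_dist 0 (t *\<^sub>R u) =
          ln (b + sqrt (b\<^sup>2 - 1)) - ln (1 / s + sqrt ((1 / s)\<^sup>2 - 1))"
        using b1 c1 by (simp add: arcosh_real_def)
      also have "\<dots> = ln (s * (b + sqrt (b\<^sup>2 - 1))) - ln (s * (1 / s + sqrt ((1 / s)\<^sup>2 - 1)))"
      proof -
        have "b + sqrt (b\<^sup>2 - 1) > 0" "1 / s + sqrt ((1 / s)\<^sup>2 - 1) > 0"
          using b1 s(1) c1 \<open>b\<^sup>2 \<ge> 1\<close> by (auto intro!: add_pos_nonneg)
        then show ?thesis using s(1) by (simp only: ln_mult_pos)
      qed
      also have "\<dots> = ln (N t / (1 + t))"
      proof -
        have "N t > 0"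
          unfolding sb[symmetric] using b1 s(1) \<open>b\<^sup>2 \<ge> 1\<close>
          by (intro mult_pos_pos add_pos_nonneg) auto
        then show ?thesis unfolding sb sc using elim by (simp add: ln_div)
      qed
      finally show ?case .
    qed
  qed
  ultimately show ?thesis
    unfolding a_def[symmetric] by (simp only: tendsto_cong)
qed

lemma busemann_eq:
  assumes "norm u = 1" and "x \<in> hyp_space"
  shows "busemann u x = ln ((1 - x \<bullet> u) / sqrt (1 - x \<bullet> x))"
  unfolding busemann_def by (rule tendsto_Lim[OF _ busemann_limit[OF assms]]) simp


text \<open>
  Two closed sets \<open>A\<close> and \<open>B\<close> are tangent at \<open>p\<close> if they touch from outside in this point only.
  Tangency of a horoball to a face means that the horoball touches the face while lying on one
  side of the plane of the face.
\<close>

definition tangent_at :: "(real ^ 3) set \<Rightarrow> (real ^ 3) set \<Rightarrow> real ^ 3 \<Rightarrow> bool" where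
  "tangent_at A B p \<longleftrightarrow> interior A \<inter> interior B = {} \<and> A \<inter> B = {p}"

definition tangent :: "(real ^ 3) set \<Rightarrow> (real ^ 3) set \<Rightarrow> bool" where
  "tangent A B \<longleftrightarrow> (\<exists>p. tangent_at A B p)"

definition tangent_to_face :: "(real ^ 3) set \<Rightarrow> (real ^ 3) set \<Rightarrow> bool" where
  "tangent_to_face B F \<longleftrightarrow> interior B \<inter> affine hull F = {} \<and> B \<inter> F \<noteq> {}"

text \<open>
  \<open>p\<close> is the foot of the perpendicular from \<open>c\<close> to the geodesic segment (or line) \<open>L\<close>; the
  geodesic from \<open>c\<close> to \<open>p\<close> has direction \<open>p - c\<close>.
\<close>

definition perp_foot :: "real ^ 3 \<Rightarrow> (real ^ 3) set \<Rightarrow> real ^ 3 \<Rightarrow> bool" where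
  "perp_foot c L p \<longleftrightarrow> p \<in> L \<inter> hyp_space \<and> (\<forall>q\<in>L. hyp_metric p (p - c) (q - p) = 0)"


text \<open>
  The cell: the regular octahedron inscribed in the unit sphere, with center at the origin. Its
  vertices are ideal, so they do not belong to the cell as a subset of hyperbolic space. The
  vertices 3 and 5 are opposite, and so are 0, 2 and 1, 4.
\<close>

definition ideal_vertex :: "nat \<Rightarrow> real ^ 3" where
  "ideal_vertex i = [axis 1 1, axis 2 1, - axis 1 1, axis 3 1, - axis 2 1, - axis 3 1] ! i"

definition octahedron :: "(real ^ 3) set" where
  "octahedron = convex hull (ideal_vertex ` {..<6})"

definition P344 :: "(real ^ 3) set" where
  "P344 = octahedron \<inter> hyp_space"

definition cell_center :: "real ^ 3" where
  "cell_center = 0"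

definition adjacent :: "nat \<Rightarrow> nat \<Rightarrow> bool" where
  "adjacent i j \<longleftrightarrow> i < 6 \<and> j < 6 \<and> i \<noteq> j \<and> closed_segment (ideal_vertex i) (ideal_vertex j) edge_of octahedron"

definition edge_midpoint :: "nat \<Rightarrow> nat \<Rightarrow> real ^ 3 \<Rightarrow> bool" where
  "edge_midpoint i j p \<longleftrightarrow> perp_foot cell_center (closed_segment (ideal_vertex i) (ideal_vertex j)) p"

definition cell_symmetry :: "(real ^ 3 \<Rightarrow> real ^ 3) \<Rightarrow> bool" where
  "cell_symmetry g \<longleftrightarrow> hyp_isometry g \<and> g ` P344 = P344"

text \<open>
  The dihedral angles of the cell are right angles, so four copies of it meet around every edge of
  the tiling (3,4,4): if the edge \<open>ab\<close> is shared by the faces \<open>abc\<close>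
  and \<open>ab(-c)\<close>, then at its midpoint \<open>p\<close> the directions \<open>c - p\<close> and \<open>-c - p\<close> in these faces are
  perpendicular to the edge and to each other.
\<close>

lemma dihedral_angle_right:
  fixes a b c :: "real ^ 3"
  assumes "norm a = 1" "norm b = 1" "norm c = 1" "a \<bullet> b = 0" "a \<bullet> c = 0" "b \<bullet> c = 0"
  defines "p \<equiv> (1 / 2) *\<^sub>R (a + b)"
  shows "hyp_metric p (c - p) (a - b) = 0" "hyp_metric p (- c - p) (a - b) = 0"
    "hyp_metric p (c - p) (- c - p) = 0"
proof -
  have "a \<bullet> a = 1" "b \<bullet> b = 1" "c \<bullet> c = 1" using assms by (simp_all add: dot_square_norm)
  moreover have "b \<bullet> a = 0" "c \<bullet> a = 0" "c \<bullet> b = 0" using assms by (simp_all add: inner_commute)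
  ultimately show "hyp_metric p (c - p) (a - b) = 0" "hyp_metric p (- c - p) (a - b) = 0"
    "hyp_metric p (c - p) (- c - p) = 0"
    using assms(4-6) unfolding hyp_metric_def p_def
    by (simp_all add: inner_diff_left inner_diff_right inner_add_left inner_add_right
        power2_eq_square)
qed


text \<open>An arrangement assigns to each index \<open>i < 6\<close> a horoball centered at \<open>ideal_vertex i\<close>.\<close>

definition horoball_arrangement :: "(nat \<Rightarrow> (real ^ 3) set) \<Rightarrow> bool" where
  "horoball_arrangement B \<longleftrightarrow> (\<forall>i<6. is_horoball (ideal_vertex i) (B i))"

definition admissible :: "(nat \<Rightarrow> (real ^ 3) set) \<Rightarrow> bool" where
  "admissible B \<longleftrightarrow> horoball_arrangement B \<and>
     (\<forall>i<6. \<forall>j<6. i \<noteq> j \<longrightarrow> interior (B i) \<inter> interior (B j) = {}) \<and>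
     (\<forall>i<6. \<forall>F. F facet_of octahedron \<and> ideal_vertex i \<notin> F \<longrightarrow> interior (B i) \<inter> F = {})"

definition packing_density :: "(nat \<Rightarrow> (real ^ 3) set) \<Rightarrow> real" where
  "packing_density B = (\<Sum>i<6. hyp_vol (B i \<inter> P344)) / hyp_vol P344"

definition optimally_dense :: "(nat \<Rightarrow> (real ^ 3) set) \<Rightarrow> bool" where
  "optimally_dense B \<longleftrightarrow>
     admissible B \<and> (\<forall>B'. admissible B' \<longrightarrow> packing_density B' \<le> packing_density B)"

definition same_type :: "(real ^ 3) set \<Rightarrow> (real ^ 3) set \<Rightarrow> bool" where
  "same_type A A' \<longleftrightarrow> (\<exists>g. cell_symmetry g \<and> g ` A = A')"

definition congruent_arrangements ::
    "(nat \<Rightarrow> (real ^ 3) set) \<Rightarrow> (nat \<Rightarrow> (real ^ 3) set) \<Rightarrow> bool" where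
  "congruent_arrangements B B' \<longleftrightarrow>
     (\<exists>g. cell_symmetry g \<and> (\<lambda>i. g ` B i) ` {..<6} = B' ` {..<6})"

definition arrangement1 :: "(nat \<Rightarrow> (real ^ 3) set) \<Rightarrow> bool" where
  "arrangement1 B \<longleftrightarrow> horoball_arrangement B \<and>
     (\<forall>i<6. \<forall>j<6. same_type (B i) (B j)) \<and>
     (\<forall>i j. adjacent i j \<longrightarrow> (\<exists>p. edge_midpoint i j p \<and> tangent_at (B i) (B j) p))"

text \<open>The size of a horoball is measured by the volume of its part in the cell.\<close>

definition arrangement2 :: "(nat \<Rightarrow> (real ^ 3) set) \<Rightarrow> bool" where
  "arrangement2 B \<longleftrightarrow> horoball_arrangement B \<and>
     (\<forall>i\<in>{3, 5}. \<forall>j\<in>{0, 1, 2, 4}. hyp_vol (B j \<inter> P344) < hyp_vol (B i \<inter> P344)) \<and>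
     tangent_at (B 3) (B 5) cell_center \<and>
     (\<forall>j\<in>{0, 1, 2, 4}. tangent (B j) (B 3) \<and> tangent (B j) (B 5))"

definition arrangement3 :: "(nat \<Rightarrow> (real ^ 3) set) \<Rightarrow> bool" where
  "arrangement3 B \<longleftrightarrow> horoball_arrangement B \<and>
     (\<forall>F. F facet_of octahedron \<and> ideal_vertex 3 \<notin> F \<longrightarrow> tangent_to_face (B 3) F) \<and>
     (\<forall>j\<in>{0, 1, 2, 4, 5}. tangent (B j) (B 3))"

end

theory Submission
  imports Defs "HOL-Real_Asymp.Real_Asymp"
begin

text \<open>
  Write a horoball at the ideal point \<open>u\<close> as \<open>(1 - x \<bullet> u)\<^sup>2 \<le> w (1 - x \<bullet> x)\<close>. In upper half-space
  coordinates with \<open>u\<close> at infinity it is a cusp over the square \<open>|a| + |b| \<le> 1\<close>, and the weight \<open>w\<close> is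
  exactly the volume of its part in the cell as long as \<open>w \<le> 2\<close>. Admissibility amounts to
  \<open>w i \<le> 2\<close>, \<open>w i * w j \<le> 1/4\<close> for adjacent and \<open>w i * w j \<le> 1\<close> for opposite vertices. If \<open>a\<close> is the
  largest weight, the total is at most \<open>6a\<close> for \<open>a \<le> 1/2\<close>, at most \<open>2a + 1/a\<close> for
  \<open>1/2 \<le> a \<le> 1\<close>, and at most \<open>a + 2/a\<close> for \<open>1 \<le> a \<le> 2\<close>; these bounds attain their maximum 3 exactly
  at \<open>a = 1/2, 1, 2\<close>, which gives the three arrangements. The volume of the cell is \<open>4G\<close> with Catalan's
  constant \<open>G\<close>, the integral of \<open>- ln x / (1 + x\<^sup>2)\<close> over the unit interval.
\<close>

section \<open>Tangency and overlap of horoballs\<close>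

text \<open>The weight \<open>w\<close> is \<open>exp (2 * c)\<close> for the Busemann level
  \<open>c\<close>. This makes the conditions multiplicative: horoballs at distinct unit vectors
  \<open>u\<close> and \<open>v\<close> are tangent when the product of their weights is
  \<open>((1 - u \<bullet> v) / 2)^2\<close>, which is 1/4 or 1 for vertices of the cell. The bounds
  for the total weight are convex in the largest weight on each of the three intervals, so only
  endpoints can be extremal. The delicate quantity is the volume of the cell. Coordinates along the
  geodesics from one vertex make the innermost integral elementary, and the symmetries of the square
  base leave the integral of \<open>4 * ln ((1 + t)^2 / (2 * t)) / (1 + t^2)\<close> over the unit
  interval. Under \<open>t \<mapsto> (1 - t) / (1 + t)\<close> the part without \<open>ln t\<close>
  changes sign, so it contributes 0. The slowly converging Catalan series is avoided:
  \<open>1 / (1 + t^2)\<close> is replaced by a polynomial in \<open>t^2\<close> with error at most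
  \<open>1 / 8^8\<close>, whose integral against \<open>- ln t\<close> is an explicit rational
  number.\<close>

definition horoball :: "real ^ 3 \<Rightarrow> real \<Rightarrow> (real ^ 3) set" where
  "horoball u w = {x \<in> hyp_space. (1 - x \<bullet> u)\<^sup>2 \<le> w * (1 - x \<bullet> x)}"

lemma hyp_space_iff: "x \<in> hyp_space \<longleftrightarrow> x \<bullet> x < 1"
  by (simp add: hyp_space_def dot_square_norm abs_square_less_1)

lemma inner_unit_less_1:
  fixes u x :: "real ^ 3"
  assumes "norm u = 1" "x \<bullet> x < 1"
  shows "x \<bullet> u < 1"
proof -
  have "norm x < 1" using assms by (simp add: dot_square_norm abs_square_less_1)
  then show ?thesis using norm_cauchy_schwarz[of x u] assms by simp
qed

lemma is_horoball_iff:
  assumes u: "norm u = 1"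
  shows "is_horoball u B \<longleftrightarrow> (\<exists>w>0. B = horoball u w)"
proof -
  have *: "{x \<in> hyp_space. busemann u x \<le> c} = horoball u ((exp c)\<^sup>2)" for c
  proof -
    have "busemann u x \<le> c \<longleftrightarrow> (1 - x \<bullet> u)\<^sup>2 \<le> (exp c)\<^sup>2 * (1 - x \<bullet> x)" if x: "x \<in> hyp_space" for x
    proof -
      have D: "1 - x \<bullet> x > 0" and p: "1 - x \<bullet> u > 0"
        using x inner_unit_less_1[OF u] by (auto simp: hyp_space_iff)
      have "busemann u x \<le> c \<longleftrightarrow> (1 - x \<bullet> u) / sqrt (1 - x \<bullet> x) \<le> exp c"
        unfolding busemann_eq[OF u x] using ln_le_cancel_iff[of "(1 - x \<bullet> u) / sqrt (1 - x \<bullet> x)" "exp c"] D p by simp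
      also have "\<dots> \<longleftrightarrow> 1 - x \<bullet> u \<le> exp c * sqrt (1 - x \<bullet> x)"
        using D by (simp add: pos_divide_le_eq)
      also have "\<dots> \<longleftrightarrow> (1 - x \<bullet> u)\<^sup>2 \<le> (exp c * sqrt (1 - x \<bullet> x))\<^sup>2"
        using D p by (subst power_mono_iff) auto
      finally show ?thesis using D by (simp add: power_mult_distrib)
    qed
    then show ?thesis by (auto simp: horoball_def)
  qed
  show ?thesis
  proof
    assume "is_horoball u B"
    then obtain c where "B = horoball u ((exp c)\<^sup>2)" by (auto simp: is_horoball_def *)
    then show "\<exists>w>0. B = horoball u w" by (intro exI[of _ "(exp c)\<^sup>2"]) auto
  next
    assume "\<exists>w>0. B = horoball u w"
    then obtain w where "w > 0" "B = horoball u w" by auto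
    moreover have "(exp (ln w / 2))\<^sup>2 = w" using \<open>w > 0\<close> by (simp add: exp_double[symmetric])
    ultimately show "is_horoball u B" using *[of "ln w / 2"]
      unfolding is_horoball_def by (intro exI[of _ "ln w / 2"]) simp
  qed
qed

text \<open>A square is nonnegative, so the strict inequality already forces
  \<open>x \<bullet> x < 1\<close>; the set is therefore open and lies in the ball without a
  separate condition.\<close>

lemma horoball_strict_subset_interior:
  assumes "w > 0"
  shows "{x. (1 - x \<bullet> u)\<^sup>2 < w * (1 - x \<bullet> x)} \<subseteq> interior (horoball u w)"
proof (rule interior_maximal)
  have "x \<bullet> x < 1" if "(1 - x \<bullet> u)\<^sup>2 < w * (1 - x \<bullet> x)" for x
  proof -
    have "0 < w * (1 - x \<bullet> x)" using that zero_le_power2[of "1 - x \<bullet> u"] by linarith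
    then show ?thesis using assms by (simp add: zero_less_mult_iff)
  qed
  then show "{x. (1 - x \<bullet> u)\<^sup>2 < w * (1 - x \<bullet> x)} \<subseteq> horoball u w"
    by (auto simp: horoball_def hyp_space_iff)
  show "open {x. (1 - x \<bullet> u)\<^sup>2 < w * (1 - x \<bullet> x)}"
    by (intro open_Collect_less continuous_intros)
qed

text \<open>The identity \<open>2 (1 - p) (1 - q) - D = (1 - p - q)^2 + y \<bullet> y\<close> bounds
  \<open>(1 - p) (1 - q)\<close> from below by \<open>D / 2\<close>, while the product of the two
  horoball inequalities bounds it from above by \<open>D / 2\<close> when
  \<open>a * b \<le> 1/4\<close>. A common point thus forces equality everywhere: it lies on the
  chord from \<open>u\<close> to \<open>v\<close>, and the product of the weights is exactly
  1/4.\<close>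

lemma horoballs_orthogonal:
  fixes u v x :: "real ^ 3"
  assumes u: "norm u = 1" and v: "norm v = 1" and uv: "u \<bullet> v = 0"
    and "a > 0" "b > 0" and ab: "a * b \<le> 1 / 4"
    and xa: "x \<in> horoball u a" and xb: "x \<in> horoball v b"
  shows "a * b = 1 / 4" "x = (1 / (1 + 2 * a)) *\<^sub>R (u + (2 * a) *\<^sub>R v)"
proof -
  define p q D where "p = x \<bullet> u" and "q = x \<bullet> v" and "D = 1 - x \<bullet> x"
  define y where "y = x - p *\<^sub>R u - q *\<^sub>R v"
  have D: "D > 0" using xa by (simp add: D_def horoball_def hyp_space_iff)
  then have p: "p < 1" and q: "q < 1"
    using inner_unit_less_1[OF u] inner_unit_less_1[OF v] by (auto simp: p_def q_def D_def)
  have uu: "u \<bullet> u = 1" "v \<bullet> v = 1" "v \<bullet> u = 0"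
    using u v uv by (auto simp: dot_square_norm inner_commute)
  have xx: "x \<bullet> x = p\<^sup>2 + q\<^sup>2 + y \<bullet> y"
    unfolding y_def using uu uv
    by (simp add: inner_diff_left inner_diff_right p_def q_def inner_commute power2_eq_square algebra_simps)
  have key: "2 * ((1 - p) * (1 - q)) - D = (1 - p - q)\<^sup>2 + y \<bullet> y"
    unfolding D_def xx by (simp add: power2_eq_square algebra_simps)
  have ha: "(1 - p)\<^sup>2 \<le> a * D" and hb: "(1 - q)\<^sup>2 \<le> b * D"
    using xa xb by (auto simp: horoball_def p_def q_def D_def)
  have "((1 - p) * (1 - q))\<^sup>2 \<le> (a * D) * (b * D)"
    unfolding power_mult_distrib using ha hb D \<open>a > 0\<close> by (intro mult_mono) auto
  also have "\<dots> = a * b * D\<^sup>2" by (simp add: power2_eq_square)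
  finally have h: "((1 - p) * (1 - q))\<^sup>2 \<le> a * b * D\<^sup>2" .
  also have "\<dots> \<le> (1 / 4) * D\<^sup>2" using ab by (intro mult_right_mono) auto
  also have "\<dots> = (D / 2)\<^sup>2" by (simp add: power2_eq_square)
  finally have "(1 - p) * (1 - q) \<le> D / 2"
    using D power2_le_imp_le[of "(1 - p) * (1 - q)" "D / 2"] by simp
  then have "(1 - p - q)\<^sup>2 + y \<bullet> y \<le> 0" using key by linarith
  then have eq: "(1 - p - q)\<^sup>2 = 0" "y \<bullet> y = 0"
    using zero_le_power2[of "1 - p - q"] inner_ge_zero[of y] by linarith+
  then have pq: "q = 1 - p" and y: "y = 0" by auto
  have D2: "(1 - p) * p * 2 = D" using key eq pq by (simp add: algebra_simps)
  then have p0: "p > 0" 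
  proof -
    have "0 < (1 - p) * p" using D2 D by linarith
    then show ?thesis using p by (simp add: zero_less_mult_iff)
  qed
  \<comment> \<open>The equality is fed back into \<open>h\<close>, which then bounds
    \<open>a * b\<close> from below.\<close>
  have "(1 - p) * (1 - q) = D / 2" using D2 pq by (simp add: mult.commute)
  with h have "(D / 2)\<^sup>2 \<le> a * b * D\<^sup>2" by simp
  then have "(1 / 4) * D\<^sup>2 \<le> a * b * D\<^sup>2" by (simp add: power2_eq_square)
  then have "1 / 4 \<le> a * b" using D by (simp add: mult_le_cancel_right)
  then show ab4: "a * b = 1 / 4" using ab by simp
  \<comment> \<open>Each horoball inequality gives one direction of
    \<open>1 - p = 2 * a * p\<close>, which fixes the position on the chord.\<close>
  have "1 - p \<le> 2 * a * p"
  proof -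
    have "(1 - p) * (1 - p) \<le> (1 - p) * (2 * a * p)"
      using ha unfolding D2[symmetric] by (simp add: power2_eq_square algebra_simps)
    then show ?thesis using p by simp
  qed
  moreover have "2 * a * p \<le> 1 - p"
  proof -
    have "p * p \<le> p * (2 * b * (1 - p))"
      using hb unfolding D2[symmetric] pq by (simp add: power2_eq_square algebra_simps)
    then have "p \<le> 2 * b * (1 - p)" using p0 by simp
    then have "2 * a * p \<le> 2 * a * (2 * b * (1 - p))" using \<open>a > 0\<close> by simp
    also have "\<dots> = 4 * (a * b) * (1 - p)" by simp
    finally show ?thesis using ab4 by simp
  qed
  ultimately have "p * (1 + 2 * a) = 1" by (simp add: algebra_simps)
  then have p': "p = 1 / (1 + 2 * a)" using \<open>a > 0\<close> by (simp add: field_simps)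
  then have q': "q = 1 / (1 + 2 * a) * (2 * a)" unfolding pq p' using \<open>a > 0\<close> by (simp add: field_simps)
  have "x = p *\<^sub>R u + q *\<^sub>R v" using y by (simp add: y_def algebra_simps)
  then show "x = (1 / (1 + 2 * a)) *\<^sub>R (u + (2 * a) *\<^sub>R v)"
    unfolding p' q' by (simp add: scaleR_add_right)
qed

text \<open>The point is where the chord from \<open>u\<close> to \<open>v\<close>, a geodesic,
  crosses the boundary of the first horoball. It lies in the second one as soon as the product of
  the weights is large enough, so the hypothesis is an inequality.\<close>

lemma tangent_point_orthogonal:
  fixes u v :: "real ^ 3"
  assumes u: "norm u = 1" and v: "norm v = 1" and uv: "u \<bullet> v = 0"
    and a: "a > 0" and ab: "a * b \<ge> 1 / 4"
  shows "(1 / (1 + 2 * a)) *\<^sub>R (u + (2 * a) *\<^sub>R v) \<in> horoball u a \<inter> horoball v b"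
proof -
  have uu: "u \<bullet> u = 1" "v \<bullet> v = 1" "v \<bullet> u = 0"
    using u v uv by (auto simp: dot_square_norm inner_commute)
  define k where "k = 1 / (1 + 2 * a)"
  define x where "x = k *\<^sub>R (u + (2 * a) *\<^sub>R v)"
  have k: "k > 0" "2 * a * k = 1 - k" using a by (auto simp: k_def field_simps)
  have xu: "x \<bullet> u = k" and xv: "x \<bullet> v = 1 - k"
    using uu uv k by (simp_all add: x_def inner_add_left mult.commute)
  have xx: "x \<bullet> x = k\<^sup>2 + (1 - k)\<^sup>2"
    unfolding x_def using uu uv
    by (simp add: inner_add_left inner_add_right k(2)[symmetric] power2_eq_square algebra_simps)
  have D: "1 - x \<bullet> x = 2 * k * (1 - k)" unfolding xx by (simp add: power2_eq_square algebra_simps)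
  have k1: "1 - k > 0" 
  proof -
    have "0 < 2 * a * k" using a k(1) by simp
    then show ?thesis using k(2) by simp
  qed
  have hx: "x \<in> hyp_space" 
  proof -
    have "0 < 2 * k * (1 - k)" using k(1) k1 by simp
    then show ?thesis using D by (simp add: hyp_space_iff)
  qed
  have "(1 - k)\<^sup>2 \<le> a * (2 * k * (1 - k))"

  proof -
    have "(1 - k)\<^sup>2 = (2 * a * k) * (1 - k)" unfolding k(2) by (simp add: power2_eq_square)
    then show ?thesis by simp
  qed
  moreover have "k\<^sup>2 \<le> b * (2 * k * (1 - k))"
  proof -
    have "k\<^sup>2 \<le> 4 * (a * b) * k\<^sup>2" using mult_right_mono[OF ab, of "4 * k\<^sup>2"] by (simp add: mult.assoc)
    also have "\<dots> = b * (2 * k * (2 * a * k))" by (simp add: power2_eq_square)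
    also have "\<dots> = b * (2 * k * (1 - k))" unfolding k(2) ..
    finally show ?thesis .
  qed
  ultimately show ?thesis
    using hx xu xv D by (simp add: horoball_def flip: k_def x_def)
qed

text \<open>The same squeeze as for orthogonal centers, now with
  \<open>(1 - p) (1 + p) - D = y \<bullet> y\<close>: the distance from the diameter through
  \<open>u\<close> is the only slack.\<close>

lemma horoballs_opposite:
  fixes u x :: "real ^ 3"
  assumes u: "norm u = 1" and "a > 0" "b > 0" and ab: "a * b \<le> 1"
    and xa: "x \<in> horoball u a" and xb: "x \<in> horoball (- u) b"
  shows "a * b = 1" "x = ((1 - a) / (1 + a)) *\<^sub>R u"
proof -
  define p D where "p = x \<bullet> u" and "D = 1 - x \<bullet> x"
  define y where "y = x - p *\<^sub>R u"
  have D: "D > 0" using xa by (simp add: D_def horoball_def hyp_space_iff)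
  then have p: "p < 1" and q: "- p < 1"
    using inner_unit_less_1[OF u, of x] inner_unit_less_1[of "-u" x] u by (auto simp: p_def D_def)
  have uu: "u \<bullet> u = 1" using u by (auto simp: dot_square_norm)
  have xx: "x \<bullet> x = p\<^sup>2 + y \<bullet> y"
    unfolding y_def using uu
    by (simp add: inner_diff_left inner_diff_right p_def inner_commute power2_eq_square algebra_simps)
  have key: "(1 - p) * (1 + p) - D = y \<bullet> y"
    unfolding D_def xx by (simp add: power2_eq_square algebra_simps)
  have ha: "(1 - p)\<^sup>2 \<le> a * D" and hb: "(1 + p)\<^sup>2 \<le> b * D"
    using xa xb by (auto simp: horoball_def p_def D_def)
  have "((1 - p) * (1 + p))\<^sup>2 \<le> (a * D) * (b * D)"
    unfolding power_mult_distrib using ha hb D \<open>a > 0\<close> by (intro mult_mono) auto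
  also have "\<dots> = a * b * D\<^sup>2" by (simp add: power2_eq_square)
  finally have h: "((1 - p) * (1 + p))\<^sup>2 \<le> a * b * D\<^sup>2" .
  also have "\<dots> \<le> 1 * D\<^sup>2" using ab by (intro mult_right_mono) auto
  finally have "(1 - p) * (1 + p) \<le> D"
    using D by (auto intro: power2_le_imp_le)
  then have eq: "y \<bullet> y = 0" using key inner_ge_zero[of y] by linarith
  then have y: "y = 0" by auto
  have D2: "(1 - p) * (1 + p) = D" using key eq by simp
  have "1 * D\<^sup>2 \<le> a * b * D\<^sup>2" using h unfolding D2 by simp
  then have "1 \<le> a * b" using D by (subst (asm) mult_le_cancel_right) auto
  then show ab4: "a * b = 1" using ab by simp
  have "1 - p \<le> a * (1 + p)"
  proof -
    have "(1 - p) * (1 - p) \<le> (1 - p) * (a * (1 + p))"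
      using ha unfolding D2[symmetric] by (simp add: power2_eq_square algebra_simps)
    then show ?thesis using p by simp
  qed
  moreover have "a * (1 + p) \<le> 1 - p"
  proof -
    have "(1 + p) * (1 + p) \<le> (1 + p) * (b * (1 - p))"
      using hb unfolding D2[symmetric] by (simp add: power2_eq_square algebra_simps)
    then have "1 + p \<le> b * (1 - p)" using q by simp
    then have "a * (1 + p) \<le> a * (b * (1 - p))" using \<open>a > 0\<close> by simp
    also have "\<dots> = (a * b) * (1 - p)" by simp
    finally show ?thesis using ab4 by simp
  qed
  ultimately have "p = (1 - a) / (1 + a)" using \<open>a > 0\<close> by (simp add: field_simps)
  then show "x = ((1 - a) / (1 + a)) *\<^sub>R u" using y by (simp add: y_def)
qed

text \<open>Here the boundary of the first horoball is intersected with the diameter through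
  \<open>u\<close>.\<close>

lemma tangent_point_opposite:
  fixes u :: "real ^ 3"
  assumes u: "norm u = 1" and a: "a > 0" and ab: "a * b \<ge> 1"
  shows "((1 - a) / (1 + a)) *\<^sub>R u \<in> horoball u a \<inter> horoball (- u) b"
proof -
  have uu: "u \<bullet> u = 1" using u by (auto simp: dot_square_norm)
  define p where "p = (1 - a) / (1 + a)"
  have p: "1 - p = a * (1 + p)" using a by (simp add: p_def field_simps)
  have p1: "1 + p > 0" using a by (simp add: p_def field_simps)
  have D: "1 - p * p = (1 - p) * (1 + p)" by (simp add: algebra_simps)
  have pp: "p * p < 1" using D p p1 a by (smt (verit) mult_pos_pos)
  have "(1 - p)\<^sup>2 \<le> a * (1 - p * p)"
    unfolding D p by (simp add: power2_eq_square algebra_simps)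
  moreover have "(1 + p)\<^sup>2 \<le> b * (1 - p * p)"
  proof -
    have "(1 + p)\<^sup>2 \<le> (a * b) * (1 + p)\<^sup>2" using mult_right_mono[OF ab, of "(1 + p)\<^sup>2"] by simp
    also have "\<dots> = b * (1 - p * p)" unfolding D p by (simp add: power2_eq_square)
    finally show ?thesis .
  qed
  ultimately show ?thesis
    using pp uu by (simp add: horoball_def hyp_space_iff flip: p_def)
qed

lemma horoball_subset_interior:
  assumes "0 < w'" "w' < w"
  shows "horoball u w' \<subseteq> interior (horoball u w)"
proof -
  have "horoball u w' \<subseteq> {x. (1 - x \<bullet> u)\<^sup>2 < w * (1 - x \<bullet> x)}"
  proof
    fix x assume "x \<in> horoball u w'"
    then have "(1 - x \<bullet> u)\<^sup>2 \<le> w' * (1 - x \<bullet> x)" "1 - x \<bullet> x > 0"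
      by (auto simp: horoball_def hyp_space_iff)
    moreover have "w' * (1 - x \<bullet> x) < w * (1 - x \<bullet> x)" using calculation(2) assms by (intro mult_strict_right_mono) auto
    ultimately show "x \<in> {x. (1 - x \<bullet> u)\<^sup>2 < w * (1 - x \<bullet> x)}"
      using le_less_trans by blast
  qed
  with horoball_strict_subset_interior[of w u] assms show ?thesis by force
qed

text \<open>If two weights have too large a product, both can be lowered until the product is the
  critical one. The tangent point of the smaller horoballs is then interior to both larger ones,
  which proves overlap without describing the interiors.\<close>

lemma shrink_product:
  fixes a b c :: real
  assumes "a > 0" "b > 0" "c > 0" "c < a * b"
  obtains a' b' where "0 < a'" "a' < a" "0 < b'" "b' < b" "a' * b' = c"
proof -
  define t where "t = sqrt (c / (a * b))"
  have "0 < t" "t < 1" using assms by (auto simp: t_def)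
  moreover have "t * t = c / (a * b)" using assms by (simp add: t_def)
  ultimately show ?thesis using assms by (intro that[of "t * a" "t * b"]) (auto simp: field_simps)
qed

lemma interiors_disjoint_orthogonal_iff:
  fixes u v :: "real ^ 3"
  assumes "norm u = 1" "norm v = 1" "u \<bullet> v = 0" "a > 0" "b > 0"
  shows "interior (horoball u a) \<inter> interior (horoball v b) = {} \<longleftrightarrow> a * b \<le> 1 / 4"
proof
  assume *: "interior (horoball u a) \<inter> interior (horoball v b) = {}"
  show "a * b \<le> 1 / 4"
  proof (rule ccontr)
    assume "\<not> a * b \<le> 1 / 4"
    then obtain a' b' where ab: "0 < a'" "a' < a" "0 < b'" "b' < b" "a' * b' = 1 / 4"
      using shrink_product[of a b "1/4"] assms by auto
    then show False
      using tangent_point_orthogonal[of u v a' b'] horoball_subset_interior[of a' a u]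
        horoball_subset_interior[of b' b v] assms * by auto
  qed
next
  assume "a * b \<le> 1 / 4"
  \<comment> \<open>At most one common point remains, and a single point has empty interior.\<close>
  then have "horoball u a \<inter> horoball v b \<subseteq> {(1 / (1 + 2 * a)) *\<^sub>R (u + (2 * a) *\<^sub>R v)}"
    using horoballs_orthogonal(2)[of u v a b] assms by auto
  then show "interior (horoball u a) \<inter> interior (horoball v b) = {}"
    by (metis interior_Int interior_mono interior_singleton subset_empty)
qed

lemma interiors_disjoint_opposite_iff:
  fixes u :: "real ^ 3"
  assumes "norm u = 1" "a > 0" "b > 0"
  shows "interior (horoball u a) \<inter> interior (horoball (- u) b) = {} \<longleftrightarrow> a * b \<le> 1"
proof
  assume *: "interior (horoball u a) \<inter> interior (horoball (- u) b) = {}"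
  show "a * b \<le> 1"
  proof (rule ccontr)
    assume "\<not> a * b \<le> 1"
    then obtain a' b' where ab: "0 < a'" "a' < a" "0 < b'" "b' < b" "a' * b' = 1"
      using shrink_product[of a b 1] assms by auto
    then show False
      using tangent_point_opposite[of u a' b'] horoball_subset_interior[of a' a u]
        horoball_subset_interior[of b' b "- u"] assms * by auto
  qed
next
  assume "a * b \<le> 1"
  then have "horoball u a \<inter> horoball (- u) b \<subseteq> {((1 - a) / (1 + a)) *\<^sub>R u}"
    using horoballs_opposite(2)[of u a b] assms by auto
  then show "interior (horoball u a) \<inter> interior (horoball (- u) b) = {}"
    by (metis interior_Int interior_mono interior_singleton subset_empty)
qed

lemma tangent_at_orthogonal:
  fixes u v :: "real ^ 3"
  assumes "norm u = 1" "norm v = 1" "u \<bullet> v = 0" "a > 0" "b > 0" "a * b = 1 / 4"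
  shows "tangent_at (horoball u a) (horoball v b) ((1 / (1 + 2 * a)) *\<^sub>R (u + (2 * a) *\<^sub>R v))"
  unfolding tangent_at_def
proof
  show "interior (horoball u a) \<inter> interior (horoball v b) = {}"
    using interiors_disjoint_orthogonal_iff[of u v a b] assms by simp
  have "(1 / (1 + 2 * a)) *\<^sub>R (u + (2 * a) *\<^sub>R v) \<in> horoball u a \<inter> horoball v b"
    by (rule tangent_point_orthogonal) (use assms in auto)
  moreover have "x = (1 / (1 + 2 * a)) *\<^sub>R (u + (2 * a) *\<^sub>R v)" if "x \<in> horoball u a" "x \<in> horoball v b" for x
    by (rule horoballs_orthogonal(2)[OF _ _ _ _ _ _ that]) (use assms in auto)
  ultimately show "horoball u a \<inter> horoball v b = {(1 / (1 + 2 * a)) *\<^sub>R (u + (2 * a) *\<^sub>R v)}" by blast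
qed

lemma tangent_at_opposite:
  fixes u :: "real ^ 3"
  assumes "norm u = 1" "a > 0" "b > 0" "a * b = 1"
  shows "tangent_at (horoball u a) (horoball (- u) b) (((1 - a) / (1 + a)) *\<^sub>R u)"
  unfolding tangent_at_def
proof
  show "interior (horoball u a) \<inter> interior (horoball (- u) b) = {}"
    using interiors_disjoint_opposite_iff[of u a b] assms by simp
  have "((1 - a) / (1 + a)) *\<^sub>R u \<in> horoball u a \<inter> horoball (- u) b"
    by (rule tangent_point_opposite) (use assms in auto)
  moreover have "x = ((1 - a) / (1 + a)) *\<^sub>R u" if "x \<in> horoball u a" "x \<in> horoball (- u) b" for x
    by (rule horoballs_opposite(2)[OF _ _ _ _ that]) (use assms in auto)
  ultimately show "horoball u a \<inter> horoball (- u) b = {((1 - a) / (1 + a)) *\<^sub>R u}" by blast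
qed

section \<open>Faces of the octahedron\<close>

lemmas vertex_simps =
  ideal_vertex_def[of 0, simplified] ideal_vertex_def[of 1, simplified]
  ideal_vertex_def[of "Suc 0", simplified] ideal_vertex_def[of 2, simplified]
  ideal_vertex_def[of 3, simplified] ideal_vertex_def[of 4, simplified] ideal_vertex_def[of 5, simplified]

lemma less_6_iff: "(i :: nat) < 6 \<longleftrightarrow> i \<in> {0, 1, 2, 3, 4, 5}"
  by auto

lemma vertices: "ideal_vertex ` {..<6} =
    {axis 1 1, axis 2 1, - axis 1 1, axis 3 1, - axis 2 1, - axis 3 1}"
proof -
  have "{..<6 :: nat} = {0, 1, 2, 3, 4, 5}" by auto
  then show ?thesis by (simp add: vertex_simps)
qed

lemma norm_vertex: "i < 6 \<Longrightarrow> norm (ideal_vertex i) = 1"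
  unfolding less_6_iff by (auto simp: vertex_simps)

text \<open>These sign vectors are the vertices of the dual cube.\<close>

definition face_normal :: "real ^ 3 \<Rightarrow> bool" where
  "face_normal n \<longleftrightarrow> (\<forall>i. n $ i \<in> {1, -1})"

lemma inner_3: "x \<bullet> y = x $ 1 * y $ 1 + x $ 2 * y $ 2 + x $ 3 * (y :: real ^ 3) $ 3"
  by (simp add: inner_vec_def sum_3)

text \<open>The sum of the absolute coordinates of \<open>x\<close> is the maximum of
  \<open>n \<bullet> x\<close> over all sign vectors, attained by the signs of \<open>x\<close>
  itself.\<close>

lemma cross_polytope_halfspaces:
  "{x :: real ^ 3. \<bar>x $ 1\<bar> + \<bar>x $ 2\<bar> + \<bar>x $ 3\<bar> \<le> 1} =
    (\<Inter>n\<in>Collect face_normal. {x. n \<bullet> x \<le> 1})" (is "?O = _")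
proof (intro set_eqI iffI)
  fix x assume "x \<in> ?O"
  then have le: "\<bar>x $ 1\<bar> + \<bar>x $ 2\<bar> + \<bar>x $ 3\<bar> \<le> 1" by simp
  show "x \<in> (\<Inter>n\<in>Collect face_normal. {x. n \<bullet> x \<le> 1})"
  proof clarify
    fix n :: "real ^ 3" assume "face_normal n"
    then have "n $ i * x $ i \<le> \<bar>x $ i\<bar>" for i
      by (auto simp: face_normal_def dest!: spec[of _ i])
    from this[of 1] this[of 2] this[of 3] le show "n \<bullet> x \<le> 1" by (simp add: inner_3)
  qed
next
  fix x assume *: "x \<in> (\<Inter>n\<in>Collect face_normal. {x. n \<bullet> x \<le> 1})"
  define n :: "real ^ 3" where "n = (\<chi> i. if x $ i < 0 then -1 else 1)"
  have "face_normal n" by (simp add: n_def face_normal_def)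
  with * have "n \<bullet> x \<le> 1" by auto
  moreover have "n $ i * x $ i = \<bar>x $ i\<bar>" for i by (simp add: n_def)
  ultimately show "x \<in> ?O" by (simp add: inner_3)
qed

lemma octahedron_eq: "octahedron = {x. \<bar>x $ 1\<bar> + \<bar>x $ 2\<bar> + \<bar>x $ 3\<bar> \<le> 1}" (is "_ = ?O")
proof
  have "convex ?O"
    unfolding cross_polytope_halfspaces by (intro convex_INT convex_halfspace_le)
  then show "octahedron \<subseteq> ?O"
    unfolding octahedron_def vertices by (intro hull_minimal) (auto simp: axis_def)
next
  show "?O \<subseteq> octahedron"
  proof
    fix x assume "x \<in> ?O"
    then have le: "\<bar>x $ 1\<bar> + \<bar>x $ 2\<bar> + \<bar>x $ 3\<bar> \<le> 1" by simp
    have V: "ideal_vertex i \<in> octahedron" if "i < 6" for i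
      using that by (auto simp: octahedron_def intro!: hull_inc)
    have cv: "convex octahedron" by (simp add: octahedron_def)
    have "(1/2) *\<^sub>R ideal_vertex 0 + (1/2) *\<^sub>R ideal_vertex 2 \<in> octahedron"
      by (intro convexD[OF cv] V) auto
    then have 0: "0 \<in> octahedron" by (simp add: vertex_simps)
    \<comment> \<open>The coefficient \<open>|x $ i|\<close> goes to the vertex on the
      \<open>i\<close>-th axis with the sign of \<open>x $ i\<close>, and the remainder goes to the
      origin.\<close>
    define c where "c = (\<lambda>n :: nat. if n = 3 then 1 - (\<bar>x $ 1\<bar> + \<bar>x $ 2\<bar> + \<bar>x $ 3\<bar>) else
        \<bar>x $ (if n = 0 then 1 else if n = 1 then 2 else 3)\<bar>)"
    define y where "y = (\<lambda>n :: nat. if n = 3 then 0 else if n = 0 then ideal_vertex (if x $ 1 < 0 then 2 else 0)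
        else if n = 1 then ideal_vertex (if x $ 2 < 0 then 4 else 1)
        else ideal_vertex (if x $ 3 < 0 then 5 else 3))"
    have 4: "{..<4 :: nat} = {0, 1, 2, 3}" by auto
    have "(\<Sum>n<4. c n *\<^sub>R y n) \<in> octahedron"
      using le by (intro convex_sum cv) (auto simp: 4 c_def y_def 0 intro!: V)
    also have "(\<Sum>n<4. c n *\<^sub>R y n) = x"
      by (auto simp: 4 c_def y_def vertex_simps vec_eq_iff forall_3 axis_def)
    finally show "x \<in> octahedron" .
  qed
qed

lemma octahedron_halfspaces: "octahedron = (\<Inter>n\<in>Collect face_normal. {x. n \<bullet> x \<le> 1})"
  unfolding octahedron_eq by (rule cross_polytope_halfspaces)

lemma finite_face_normals: "finite (Collect face_normal)"
proof -
  have "n \<in> (\<lambda>(a, b, c). vector [a, b, c]) ` ({1, -1} \<times> {1, -1} \<times> {1, -1})" if "face_normal n" for n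
    using that by (intro image_eqI[of _ _ "(n $ 1, n $ 2, n $ 3)"])
      (auto simp: face_normal_def vec_eq_iff forall_3)
  then have "Collect face_normal \<subseteq> (\<lambda>(a, b, c). vector [a, b, c]) ` ({1, -1} \<times> {1, -1} \<times> {1, -1})"
    by blast
  then show ?thesis by (rule finite_subset) simp
qed

lemma face_normal_inner_self:
  assumes "face_normal n"
  shows "n \<bullet> n = 3"
proof -
  have "n $ k * n $ k = 1" for k
    using assms by (auto simp: face_normal_def dest!: spec[of _ k])
  then show ?thesis by (simp add: inner_3)
qed

lemma face_normal_inner:
  assumes "face_normal m" "face_normal n" "m \<noteq> n"
  shows "m \<bullet> n \<le> 1"
proof -
  have mn: "m $ k * n $ k = (if m $ k = n $ k then 1 else -1)" for k
    using assms(1,2) by (auto simp: face_normal_def dest!: spec[of _ k])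
  have "m $ 1 \<noteq> n $ 1 \<or> m $ 2 \<noteq> n $ 2 \<or> m $ 3 \<noteq> n $ 3"
    using assms(3) by (simp add: vec_eq_iff forall_3)
  then show ?thesis unfolding inner_3 mn by auto
qed

text \<open>The facet criterion for polyhedra needs an irredundant system of half-spaces. Dropping
  the one of \<open>n\<close> admits \<open>(1/2) *\<^sub>R n\<close>: it violates the inequality of
  \<open>n\<close>, where its value is 3/2, but distinct sign vectors have inner product at most 1,
  so every other value is at most 1/2.\<close>

lemma facet_of_octahedron:
  "C facet_of octahedron \<longleftrightarrow> (\<exists>n. face_normal n \<and> C = octahedron \<inter> {x. n \<bullet> x = 1})"
proof -
  define h where "h n = {x. n \<bullet> x \<le> (1 :: real)}" for n :: "real ^ 3"
  have inj: "inj_on h (Collect face_normal)"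
  proof (rule inj_onI, rule ccontr)
    fix m n assume *: "m \<in> Collect face_normal" "n \<in> Collect face_normal" "h m = h n" "m \<noteq> n"
    then have "n \<bullet> n = 3" "m \<bullet> n \<le> 1" using face_normal_inner[of m n] face_normal_inner_self[of n] by auto
    then have "(1 / 2) *\<^sub>R n \<in> h m" "(1 / 2) *\<^sub>R n \<notin> h n" by (auto simp: h_def)
    then show False using *(3) by simp
  qed
  \<comment> \<open>The criterion is indexed by half-spaces rather than by normals, so each
    half-space must determine its normal; this is what the injectivity of \<open>h\<close>
    provides.\<close>
  define nrm where "nrm = the_inv_into (Collect face_normal) h"
  have nrm: "nrm (h n) = n" if "face_normal n" for n
    using inj that by (simp add: nrm_def the_inv_into_f_f)
  have aff: "affine hull octahedron = UNIV"
  proof -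
    have "open {x :: real ^ 3. \<bar>x $ 1\<bar> + \<bar>x $ 2\<bar> + \<bar>x $ 3\<bar> < 1}"
      by (intro open_Collect_less continuous_intros)
    then have "{x :: real ^ 3. \<bar>x $ 1\<bar> + \<bar>x $ 2\<bar> + \<bar>x $ 3\<bar> < 1} \<subseteq> interior octahedron"
      by (intro interior_maximal) (auto simp: octahedron_eq)
    moreover have "(0 :: real ^ 3) \<in> {x. \<bar>x $ 1\<bar> + \<bar>x $ 2\<bar> + \<bar>x $ 3\<bar> < 1}" by simp
    ultimately show ?thesis by (intro affine_hull_nonempty_interior) blast
  qed
  have "C facet_of octahedron \<longleftrightarrow>
      (\<exists>H. H \<in> h ` Collect face_normal \<and> C = octahedron \<inter> {x. nrm H \<bullet> x = 1})"
  proof (rule facet_of_polyhedron_explicit)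
    show "finite (h ` Collect face_normal)" using finite_face_normals by simp
    show "octahedron = affine hull octahedron \<inter> \<Inter>(h ` Collect face_normal)"
      unfolding aff h_def using octahedron_halfspaces by simp
  next
    fix H assume "H \<in> h ` Collect face_normal"
    then obtain n where n: "face_normal n" "H = h n" by auto
    then have "n \<noteq> 0" by (auto simp: face_normal_def)
    then show "nrm H \<noteq> 0 \<and> H = {x. nrm H \<bullet> x \<le> 1}" using n nrm by (simp add: h_def)
  next
    fix F assume F: "F \<subset> h ` Collect face_normal"
    then obtain n where n: "face_normal n" "h n \<notin> F" by auto
    have "(1 / 2) *\<^sub>R n \<in> H" if "H \<in> F" for H
    proof -
      obtain m where m: "face_normal m" "H = h m" using F \<open>H \<in> F\<close> by blast
      then have "m \<noteq> n" using n that by auto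
      then show ?thesis using face_normal_inner[of m n] m n by (simp add: h_def)
    qed
    moreover have "(1 / 2) *\<^sub>R n \<notin> octahedron"
    proof -
      have "n \<bullet> n = 3" using n(1) by (rule face_normal_inner_self)
      then have "n \<bullet> ((1 / 2) *\<^sub>R n) > 1" by simp
      then show ?thesis unfolding octahedron_halfspaces using n by force
    qed
    moreover have "octahedron \<subseteq> \<Inter>F"
      unfolding octahedron_halfspaces using F by (auto simp: h_def)
    ultimately show "octahedron \<subset> affine hull octahedron \<inter> \<Inter>F" unfolding aff by blast
  qed
  then show ?thesis using nrm by auto
qed

lemma facet_avoiding_vertex:
  assumes i: "i < 6" and F: "F facet_of octahedron" and notin: "ideal_vertex i \<notin> F"
  obtains n where "face_normal n" "F = octahedron \<inter> {x. n \<bullet> x = 1}" "n \<bullet> ideal_vertex i = -1"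
proof -
  obtain n where n: "face_normal n" "F = octahedron \<inter> {x. n \<bullet> x = 1}"
    using F facet_of_octahedron by blast
  have "ideal_vertex i \<in> octahedron"
    using i by (auto simp: octahedron_def intro!: hull_inc)
  then have "n \<bullet> ideal_vertex i \<noteq> 1" using notin n(2) by simp
  moreover have "n $ k \<in> {1, -1}" for k using n(1) by (simp add: face_normal_def)
  from this[of 1] this[of 2] this[of 3] have "n \<bullet> ideal_vertex i \<in> {1, -1}"
    using i unfolding less_6_iff by (auto simp: vertex_simps inner_axis)
  ultimately show ?thesis using n that by blast
qed

text \<open>Since \<open>n \<bullet> ideal_vertex i = -1\<close>, the vector \<open>m\<close> is the
  part of \<open>n\<close> orthogonal to the vertex, with \<open>m \<bullet> m = 2\<close>.
  Cauchy-Schwarz against the orthogonal part \<open>y\<close> of \<open>x\<close> and the horoball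
  inequality at weight 2 give \<open>(n \<bullet> x + z)^2 \<le> (1 + z)^2 - 4 * z^2\<close>. The
  bound is critical only at \<open>z = 0\<close>, which is where contact happens for weight
  2.\<close>

lemma horoball_face_halfspace:
  assumes i: "i < 6" and n: "face_normal n" "n \<bullet> ideal_vertex i = -1" and w: "w \<le> 2"
  shows "horoball (ideal_vertex i) w \<subseteq> {x. n \<bullet> x \<le> 1}"
proof
  fix x assume "x \<in> horoball (ideal_vertex i) w"
  then have D: "1 - x \<bullet> x > 0" and "(1 - x \<bullet> ideal_vertex i)\<^sup>2 \<le> w * (1 - x \<bullet> x)"
    by (auto simp: horoball_def hyp_space_iff)
  moreover have "w * (1 - x \<bullet> x) \<le> 2 * (1 - x \<bullet> x)" using w D by (intro mult_right_mono) auto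
  ultimately have le: "(1 - x \<bullet> ideal_vertex i)\<^sup>2 \<le> 2 * (1 - x \<bullet> x)" by linarith
  define z where "z = x \<bullet> ideal_vertex i"
  define y where "y = x - z *\<^sub>R ideal_vertex i"
  define m where "m = n + ideal_vertex i"
  have uu: "ideal_vertex i \<bullet> ideal_vertex i = 1" using norm_vertex[OF i] by (simp add: dot_square_norm)
  note nn = face_normal_inner_self[OF n(1)]
  have mm: "m \<bullet> m = 2"
    unfolding m_def using uu nn n(2) by (simp add: inner_add_left inner_add_right inner_commute)
  have xx: "x \<bullet> x = z\<^sup>2 + y \<bullet> y"
    unfolding y_def using uu
    by (simp add: inner_diff_left inner_diff_right z_def inner_commute power2_eq_square algebra_simps)
  have my: "m \<bullet> y = n \<bullet> x + z"
    unfolding y_def m_def using uu n(2)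
    by (simp add: inner_add_left inner_diff_right z_def inner_commute algebra_simps)
  have "(m \<bullet> y)\<^sup>2 \<le> 2 * (y \<bullet> y)" using Cauchy_Schwarz_ineq[of m y] mm by simp
  also have "\<dots> = 2 * (1 - z\<^sup>2) - 2 * (1 - x \<bullet> x)" unfolding xx by simp
  also have "\<dots> \<le> 2 * (1 - z\<^sup>2) - (1 - z)\<^sup>2" using le by (simp add: z_def)
  also have "\<dots> = (1 + z)\<^sup>2 - 4 * z\<^sup>2" by (simp add: power2_eq_square algebra_simps)
  finally have "(n \<bullet> x + z)\<^sup>2 \<le> (1 + z)\<^sup>2" using my by (smt (verit) zero_le_power2)
  moreover have "0 < 1 + z"
    using inner_unit_less_1[of "- ideal_vertex i" x] norm_vertex[OF i] D by (simp add: z_def)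
  ultimately have "n \<bullet> x + z \<le> 1 + z" by (meson less_imp_le power2_le_imp_le)
  then show "x \<in> {x. n \<bullet> x \<le> 1}" by simp
qed

lemma face_condition_iff:
  assumes i: "i < 6" and w: "w > 0"
  shows "(\<forall>F. F facet_of octahedron \<and> ideal_vertex i \<notin> F \<longrightarrow> interior (horoball (ideal_vertex i) w) \<inter> F = {})
    \<longleftrightarrow> w \<le> 2"
proof
  assume *: "\<forall>F. F facet_of octahedron \<and> ideal_vertex i \<notin> F \<longrightarrow> interior (horoball (ideal_vertex i) w) \<inter> F = {}"
  show "w \<le> 2"
  proof (rule ccontr)
    assume w2: "\<not> w \<le> 2"
    \<comment> \<open>The witness \<open>x\<close> is the midpoint of an edge in the equator
      opposite to the vertex, and \<open>n\<close> belongs to the facet behind that edge. At this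
      point the strict horoball inequality reads \<open>1 < w / 2\<close>.\<close>
    have "\<exists>n x. face_normal n \<and> n \<bullet> ideal_vertex i = -1 \<and> n \<bullet> x = 1 \<and> x \<in> octahedron
        \<and> x \<bullet> x = 1 / 2 \<and> x \<bullet> ideal_vertex i = 0"
    proof -
      define N where "N = (\<lambda>a b c. vector [a, b, c] :: real ^ 3)"
      have N: "N a b c $ 1 = a" "N a b c $ 2 = b" "N a b c $ 3 = c" for a b c by (auto simp: N_def)
      have fN: "face_normal (N a b c)" if "a \<in> {1, -1}" "b \<in> {1, -1}" "c \<in> {1, -1}" for a b c
        using that by (auto simp: face_normal_def forall_3 N)
      consider "ideal_vertex i = N 1 0 0" | "ideal_vertex i = N 0 1 0" | "ideal_vertex i = N 0 0 1"
        | "ideal_vertex i = N (-1) 0 0" | "ideal_vertex i = N 0 (-1) 0" | "ideal_vertex i = N 0 0 (-1)"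
        using i unfolding less_6_iff by (auto simp: vertex_simps vec_eq_iff forall_3 axis_def N)
      then show ?thesis
      proof cases
        case 1 show ?thesis unfolding 1
          by (rule exI[of _ "N (-1) 1 1"], rule exI[of _ "N 0 (1/2) (1/2)"]) (auto simp: inner_3 N octahedron_eq fN)
      next
        case 2 show ?thesis unfolding 2
          by (rule exI[of _ "N 1 (-1) 1"], rule exI[of _ "N (1/2) 0 (1/2)"]) (auto simp: inner_3 N octahedron_eq fN)
      next
        case 3 show ?thesis unfolding 3
          by (rule exI[of _ "N 1 1 (-1)"], rule exI[of _ "N (1/2) (1/2) 0"]) (auto simp: inner_3 N octahedron_eq fN)
      next
        case 4 show ?thesis unfolding 4
          by (rule exI[of _ "N 1 1 1"], rule exI[of _ "N 0 (1/2) (1/2)"]) (auto simp: inner_3 N octahedron_eq fN)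
      next
        case 5 show ?thesis unfolding 5
          by (rule exI[of _ "N 1 1 1"], rule exI[of _ "N (1/2) 0 (1/2)"]) (auto simp: inner_3 N octahedron_eq fN)
      next
        case 6 show ?thesis unfolding 6
          by (rule exI[of _ "N 1 1 1"], rule exI[of _ "N (1/2) (1/2) 0"]) (auto simp: inner_3 N octahedron_eq fN)
      qed
    qed
    then obtain n x where nx: "face_normal n" "n \<bullet> ideal_vertex i = -1" "n \<bullet> x = 1" "x \<in> octahedron"
      "x \<bullet> x = 1 / 2" "x \<bullet> ideal_vertex i = 0" by blast
    define F where "F = octahedron \<inter> {x. n \<bullet> x = 1}"
    have "F facet_of octahedron" "ideal_vertex i \<notin> F" "x \<in> F"
      using nx facet_of_octahedron by (auto simp: F_def)
    moreover have "x \<in> interior (horoball (ideal_vertex i) w)"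
    proof -
      have "(1 - x \<bullet> ideal_vertex i)\<^sup>2 < w * (1 - x \<bullet> x)" unfolding nx using w2 by simp
      then show ?thesis using horoball_strict_subset_interior[OF w, of "ideal_vertex i"] by blast
    qed
    ultimately show False using * by blast
  qed
next
  assume w2: "w \<le> 2"
  show "\<forall>F. F facet_of octahedron \<and> ideal_vertex i \<notin> F \<longrightarrow> interior (horoball (ideal_vertex i) w) \<inter> F = {}"
  proof (intro allI impI, elim conjE)
    fix F assume "F facet_of octahedron" "ideal_vertex i \<notin> F"
    then obtain n where n: "face_normal n" "F = octahedron \<inter> {x. n \<bullet> x = 1}" "n \<bullet> ideal_vertex i = -1"
      by (rule facet_avoiding_vertex[OF i])
    then have "n \<noteq> 0" by auto
    have "interior (horoball (ideal_vertex i) w) \<subseteq> interior {x. n \<bullet> x \<le> 1}"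
      using horoball_face_halfspace[OF i n(1,3) w2] by (rule interior_mono)
    then show "interior (horoball (ideal_vertex i) w) \<inter> F = {}"
      using \<open>n \<noteq> 0\<close> n by auto
  qed
qed

section \<open>Volumes in half-space coordinates\<close>

lemma emeasure_lborel_Times:
  fixes A :: "'a :: euclidean_space set" and B :: "'b :: euclidean_space set"
  assumes "A \<in> sets borel" "B \<in> sets borel"
  shows "emeasure lborel (A \<times> B) = emeasure lborel A * emeasure lborel B"
  by (subst lborel_prod[symmetric], rule lborel.emeasure_pair_measure_Times) (use assms in auto)

text \<open>Lebesgue measure is determined by its values on boxes, and the preimage of a box is a
  box with the same side lengths because \<open>j\<close>, \<open>k\<close>, \<open>l\<close>
  exhaust the coordinates.\<close>

lemma lborel_axes:
  fixes j k l :: 3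
  assumes "j \<noteq> k" "j \<noteq> l" "k \<noteq> l"
  shows "(lborel :: (real ^ 3) measure) =
    distr lborel borel (\<lambda>(x, y, z). x *\<^sub>R axis j 1 + y *\<^sub>R axis k 1 + z *\<^sub>R axis l 1)"
    (is "_ = distr _ _ ?T")
proof (rule lborel_eqI)
  have jkl: "UNIV = {j, k, l}"
  proof -
    have "card {j, k, l} = CARD(3)" using assms by simp
    then show ?thesis by (metis card_subset_eq finite subset_UNIV)
  qed
  fix L U :: "real ^ 3"
  assume le: "\<And>b. b \<in> Basis \<Longrightarrow> L \<bullet> b \<le> U \<bullet> b"
  have LU: "L $ i \<le> U $ i" for i
    using le[of "axis i 1"] by (simp add: inner_axis axis_in_Basis_iff)
  have [measurable]: "?T \<in> borel \<rightarrow>\<^sub>M borel"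
    unfolding split_beta by (intro borel_measurable_continuous_onI continuous_intros)
  have vim: "?T -` box L U = box (L $ j) (U $ j) \<times> box (L $ k) (U $ k) \<times> box (L $ l) (U $ l)"
  proof (rule set_eqI)
    fix t :: "real \<times> real \<times> real"
    obtain x y z where t: "t = (x, y, z)" by (cases t) auto
    define w where "w = x *\<^sub>R axis j 1 + y *\<^sub>R axis k 1 + z *\<^sub>R (axis l 1 :: real ^ 3)"
    have w: "w $ j = x" "w $ k = y" "w $ l = z"
      using assms by (simp_all add: w_def axis_def)
    have "w \<in> box L U \<longleftrightarrow> (\<forall>i\<in>UNIV. L $ i < w $ i \<and> w $ i < U $ i)"
      by (simp add: mem_box_cart)
    also have "\<dots> \<longleftrightarrow> t \<in> box (L $ j) (U $ j) \<times> box (L $ k) (U $ k) \<times> box (L $ l) (U $ l)"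
      unfolding jkl by (auto simp: w t)
    finally show "t \<in> ?T -` box L U \<longleftrightarrow>
        t \<in> box (L $ j) (U $ j) \<times> box (L $ k) (U $ k) \<times> box (L $ l) (U $ l)"
      by (simp add: t w_def)
  qed
  have "emeasure (distr lborel borel ?T) (box L U) =
      emeasure (lborel :: (real \<times> real \<times> real) measure)
        (box (L $ j) (U $ j) \<times> box (L $ k) (U $ k) \<times> box (L $ l) (U $ l))"
    by (subst emeasure_distr) (auto simp: vim)
  also have "\<dots> = ennreal (U $ j - L $ j) * (ennreal (U $ k - L $ k) * ennreal (U $ l - L $ l))"
    by (simp add: emeasure_lborel_Times borel_Times LU)
  also have "\<dots> = ennreal (\<Prod>i\<in>UNIV. (U - L) $ i)"
    unfolding jkl using assms LU by (simp add: ennreal_mult'')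
  also have "(\<Prod>i\<in>UNIV. (U - L) $ i) = (\<Prod>b\<in>Basis. (U - L) \<bullet> b)"
  proof -
    have B: "(Basis :: (real ^ 3) set) = (\<lambda>i. axis i 1) ` UNIV"
      by (auto simp: Basis_vec_def)
    show ?thesis unfolding B
      by (subst prod.reindex) (auto simp: inj_on_def axis_eq_axis inner_axis)
  qed
  finally show "emeasure (distr lborel borel ?T) (box L U) = ennreal (\<Prod>b\<in>Basis. (U - L) \<bullet> b)" .
qed simp

text \<open>The permuted axes and the common sign \<open>e\<close> let a single computation serve
  all six vertices: each of them becomes \<open>axis l e\<close>, the direction of the outermost
  integral.\<close>

lemma nn_integral_axes:
  fixes j k l :: 3 and e :: real
  assumes [measurable]: "f \<in> borel_measurable borel"
    and "j \<noteq> k" "j \<noteq> l" "k \<noteq> l" and e: "e \<in> {1, -1}"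
  shows "(\<integral>\<^sup>+x. f x \<partial>(lborel :: (real ^ 3) measure)) =
    (\<integral>\<^sup>+z. \<integral>\<^sup>+y. \<integral>\<^sup>+x. f (x *\<^sub>R axis j e + y *\<^sub>R axis k e + z *\<^sub>R axis l e)
       \<partial>lborel \<partial>lborel \<partial>lborel)"
proof -
  define T :: "real \<times> real \<times> real \<Rightarrow> real ^ 3"
    where "T = (\<lambda>(x, y, z). x *\<^sub>R axis j 1 + y *\<^sub>R axis k 1 + z *\<^sub>R axis l 1)"
  have [measurable]: "T \<in> borel \<rightarrow>\<^sub>M borel"
    unfolding T_def split_beta by (intro borel_measurable_continuous_onI continuous_intros)
  have ax: "axis i e = e *\<^sub>R (axis i 1 :: real ^ 3)" for i :: 3
    by (simp add: vec_eq_iff axis_def)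
  define g where "g = (\<lambda>t. f (e *\<^sub>R T t))"
  have [measurable]: "g \<in> borel_measurable borel" unfolding g_def by measurable
  have "distr lborel borel ((*\<^sub>R) e) = (lborel :: (real ^ 3) measure)"
  proof -
    have "(lborel :: (real ^ 3) measure) = density (distr lborel borel (\<lambda>x. 0 + e *\<^sub>R x)) (\<lambda>_. \<bar>e\<bar> ^ DIM(real ^ 3))"
      using e by (intro lborel_affine) auto
    moreover have "\<bar>e\<bar> = 1" using e by auto
    ultimately show ?thesis by (simp add: density_1)
  qed
  then have "(\<integral>\<^sup>+x. f x \<partial>lborel) = (\<integral>\<^sup>+x. f (e *\<^sub>R x) \<partial>(lborel :: (real ^ 3) measure))"
    using nn_integral_distr[of "(*\<^sub>R) e" lborel borel f] by simp
  also have "\<dots> = (\<integral>\<^sup>+t. g t \<partial>lborel)"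
    by (subst lborel_axes[OF assms(2-4), folded T_def], subst nn_integral_distr) (auto simp: g_def)
  also have "\<dots> = (\<integral>\<^sup>+z. \<integral>\<^sup>+y. \<integral>\<^sup>+x. g (x, y, z) \<partial>lborel \<partial>lborel \<partial>lborel)"
  proof -
    have [measurable]: "g \<in> borel_measurable (lborel \<Otimes>\<^sub>M (lborel \<Otimes>\<^sub>M lborel))"
      by (simp add: lborel_prod)
    have m2: "(\<lambda>yz. \<integral>\<^sup>+x. g (x, yz) \<partial>lborel) \<in> borel_measurable (lborel \<Otimes>\<^sub>M lborel)"
      by measurable
    have "(\<integral>\<^sup>+t. g t \<partial>lborel) = (\<integral>\<^sup>+t. g t \<partial>(lborel \<Otimes>\<^sub>M (lborel \<Otimes>\<^sub>M lborel)))"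
      by (simp add: lborel_prod)
    also have "\<dots> = (\<integral>\<^sup>+yz. \<integral>\<^sup>+x. g (x, yz) \<partial>lborel \<partial>(lborel \<Otimes>\<^sub>M lborel))"
    proof -
      interpret pair_sigma_finite "lborel :: real measure" "lborel \<Otimes>\<^sub>M lborel :: (real \<times> real) measure"
        by (simp add: pair_sigma_finite_def lborel.sigma_finite_measure_axioms lborel_prod)
      show ?thesis by (rule nn_integral_snd[symmetric]) measurable
    qed
    also have "\<dots> = (\<integral>\<^sup>+z. \<integral>\<^sup>+y. \<integral>\<^sup>+x. g (x, y, z) \<partial>lborel \<partial>lborel \<partial>lborel)"
      by (rule lborel_pair.nn_integral_snd[OF m2, symmetric])
    finally show ?thesis .
  qed
  finally show ?thesis by (simp add: g_def T_def ax scaleR_add_right mult.commute)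
qed

lemma nn_integral_lborel_swap:
  fixes f :: "real \<Rightarrow> real \<Rightarrow> ennreal"
  assumes "(\<lambda>(x, y). f x y) \<in> borel_measurable (lborel \<Otimes>\<^sub>M lborel)"
  shows "(\<integral>\<^sup>+x. \<integral>\<^sup>+y. f x y \<partial>lborel \<partial>lborel) = (\<integral>\<^sup>+y. \<integral>\<^sup>+x. f x y \<partial>lborel \<partial>lborel)"
  by (rule lborel_pair.Fubini'[symmetric]) (use assms in simp)

lemma nn_integral_scale:
  fixes s :: real
  assumes [measurable]: "f \<in> borel_measurable borel" and s: "s > 0"
  shows "(\<integral>\<^sup>+x. f x \<partial>lborel) = ennreal s * (\<integral>\<^sup>+a. f (s * a) \<partial>lborel)"
  using nn_integral_real_affine[of f s 0] s by simp

text \<open>For fixed \<open>a\<close> and \<open>b\<close> the points run along a chord issuing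
  from the ideal point \<open>axis l e\<close>, hence along a geodesic ending there, and
  \<open>s\<close> is the depth below that point. The factor \<open>s\<close> of
  \<open>1 - x \<bullet> x\<close> reflects that the chord starts on the sphere.\<close>

lemma cone_inner:
  fixes j k l :: 3 and e :: real
  assumes jkl: "j \<noteq> k" "j \<noteq> l" "k \<noteq> l" and e: "e \<in> {1, -1}"
    and x: "x = (s * a) *\<^sub>R axis j e + (s * b) *\<^sub>R axis k e + (1 - s) *\<^sub>R (axis l e :: real ^ 3)"
  shows "1 - x \<bullet> x = s * (2 - s * (1 + a\<^sup>2 + b\<^sup>2))" "1 - x \<bullet> axis l e = s"
proof -
  have ee: "e * e = 1" using e by auto
  have *: "axis j e \<bullet> axis k e = 0" "axis j e \<bullet> axis l e = 0" "axis k e \<bullet> axis l e = 0"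
    "axis k e \<bullet> axis j e = 0" "axis l e \<bullet> axis j e = 0" "axis l e \<bullet> axis k e = 0"
    "axis i e \<bullet> axis i e = 1" for i :: 3
    using jkl ee by (auto simp: inner_axis_axis)
  show "1 - x \<bullet> x = s * (2 - s * (1 + a\<^sup>2 + b\<^sup>2))"
    unfolding x by (simp add: inner_add_left inner_add_right *) (simp add: power2_eq_square algebra_simps)
  show "1 - x \<bullet> axis l e = s"
    unfolding x by (simp add: inner_add_left *)
qed

text \<open>The coordinates are those of the upper half-space with the ideal point \<open>axis l e\<close> at
  infinity: \<open>(a, b)\<close> is the horizontal position, and the squared height is
  \<open>2 / s - (1 + a\<^sup>2 + b\<^sup>2)\<close>.\<close>

lemma emeasure_hyp_cone:
  fixes j k l :: 3 and e :: real
  assumes jkl: "j \<noteq> k" "j \<noteq> l" "k \<noteq> l" and e: "e \<in> {1, -1}"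
    and A[measurable]: "A \<in> sets borel" and "A \<subseteq> hyp_space"
  shows "emeasure hyp_measure A = (\<integral>\<^sup>+a. \<integral>\<^sup>+b. \<integral>\<^sup>+s.
      indicator {0<..} s * indicator A ((s * a) *\<^sub>R axis j e + (s * b) *\<^sub>R axis k e + (1 - s) *\<^sub>R axis l e)
      * ennreal (1 / (2 - s * (1 + a\<^sup>2 + b\<^sup>2))\<^sup>2) \<partial>lborel \<partial>lborel \<partial>lborel)"
proof -
  define f :: "real ^ 3 \<Rightarrow> ennreal" where "f x = indicator A x * ennreal (1 / (1 - x \<bullet> x)\<^sup>2)" for x
  have [measurable]: "f \<in> borel_measurable borel" unfolding f_def by measurable
  define X where "X a b z = a *\<^sub>R axis j e + b *\<^sub>R axis k e + z *\<^sub>R (axis l e :: real ^ 3)" for a b z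
  have Xm [measurable (raw)]: "(\<lambda>p. X (g p) (h p) (i p)) \<in> borel_measurable M"
    if [measurable]: "g \<in> borel_measurable M" "h \<in> borel_measurable M" "i \<in> borel_measurable M"
    for g h i :: "'b \<Rightarrow> real" and M
    unfolding X_def by measurable
  define F where "F a b s = indicator {0<..} s * indicator A (X (s * a) (s * b) (1 - s))
      * ennreal (1 / (2 - s * (1 + a\<^sup>2 + b\<^sup>2))\<^sup>2)" for a b s
  have Fm [measurable (raw)]: "(\<lambda>p. F (g p) (h p) (i p)) \<in> borel_measurable M"
    if [measurable]: "g \<in> borel_measurable M" "h \<in> borel_measurable M" "i \<in> borel_measurable M"
    for g h i :: "'b \<Rightarrow> real" and M
    unfolding F_def X_def by measurable
  \<comment> \<open>The two scalings contribute a factor \<open>s\<close> each; together they cancel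
    the \<open>s^2\<close> in \<open>(1 - x \<bullet> x)^2\<close>.\<close>
  have scale: "ennreal s * (ennreal s * f (X (s * a) (s * b) (1 - s))) = F a b s" if s: "s > 0" for s a b
  proof -
    have "1 - X (s * a) (s * b) (1 - s) \<bullet> X (s * a) (s * b) (1 - s) = s * (2 - s * (1 + a\<^sup>2 + b\<^sup>2))"
      unfolding X_def by (rule cone_inner(1)[OF jkl e refl])
    then have "f (X (s * a) (s * b) (1 - s)) =
        indicator A (X (s * a) (s * b) (1 - s)) * ennreal (1 / (s * (2 - s * (1 + a\<^sup>2 + b\<^sup>2)))\<^sup>2)"
      by (simp add: f_def)
    moreover have "ennreal s * (ennreal s * ennreal (1 / (s * (2 - s * (1 + a\<^sup>2 + b\<^sup>2)))\<^sup>2)) =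
        ennreal (1 / (2 - s * (1 + a\<^sup>2 + b\<^sup>2))\<^sup>2)"
    proof -
      have "s * (s * (1 / (s * (2 - s * (1 + a\<^sup>2 + b\<^sup>2)))\<^sup>2)) = 1 / (2 - s * (1 + a\<^sup>2 + b\<^sup>2))\<^sup>2"
        using s by (simp add: power_mult_distrib) (simp add: power2_eq_square)
      then show ?thesis using s by (simp add: ennreal_mult'[symmetric])
    qed
    ultimately show ?thesis using s by (cases "X (s * a) (s * b) (1 - s) \<in> A") (simp_all add: F_def)
  qed
  \<comment> \<open>For \<open>s \<le> 0\<close> the last coordinate is at least 1 in absolute
    value, so the point is outside the ball; the restriction to positive \<open>s\<close>, where
    scaling is possible, loses nothing.\<close>
  have zero: "f (X a b (1 - s)) = 0" "F a b s = 0" if "\<not> s > 0" for s a b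
  proof -
    have "X a b (1 - s) \<notin> A"
    proof
      assume "X a b (1 - s) \<in> A"
      then have "X a b (1 - s) \<bullet> X a b (1 - s) < 1"
        using assms by (auto simp: hyp_space_def dot_square_norm abs_square_less_1)
      moreover have "X a b (1 - s) \<bullet> X a b (1 - s) = a\<^sup>2 + b\<^sup>2 + (1 - s)\<^sup>2"
        using jkl e by (auto simp: X_def inner_add_left inner_add_right inner_axis_axis power2_eq_square)
      moreover have "1 \<le> (1 - s)\<^sup>2" using that one_le_power[of "1 - s" 2] by simp
      ultimately show False using zero_le_power2[of a] zero_le_power2[of b] by linarith
    qed
    then show "f (X a b (1 - s)) = 0" "F a b s = 0" using that by (auto simp: f_def F_def)
  qed
  have "emeasure hyp_measure A = (\<integral>\<^sup>+x. f x \<partial>lborel)"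
  proof -
    have [measurable]: "hyp_space \<in> sets borel" by (simp add: hyp_space_def)
    show ?thesis unfolding hyp_measure_def
      using assms by (subst emeasure_density) (auto intro!: nn_integral_cong simp: f_def indicator_def)
  qed
  also have "\<dots> = (\<integral>\<^sup>+z. \<integral>\<^sup>+y. \<integral>\<^sup>+x. f (X x y z) \<partial>lborel \<partial>lborel \<partial>lborel)"
    unfolding X_def using jkl e by (intro nn_integral_axes) auto
  also have "\<dots> = (\<integral>\<^sup>+s. \<integral>\<^sup>+y. \<integral>\<^sup>+x. f (X x y (1 - s)) \<partial>lborel \<partial>lborel \<partial>lborel)"
  proof -
    have "(\<lambda>z. \<integral>\<^sup>+y. \<integral>\<^sup>+x. f (X x y z) \<partial>lborel \<partial>lborel) \<in> borel_measurable borel"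
      by measurable
    from nn_integral_real_affine[OF this, of "-1" 1] show ?thesis by simp
  qed
  also have "\<dots> = (\<integral>\<^sup>+s. \<integral>\<^sup>+b. \<integral>\<^sup>+a. F a b s \<partial>lborel \<partial>lborel \<partial>lborel)"
  proof (rule nn_integral_cong)
    fix s :: real
    show "(\<integral>\<^sup>+y. \<integral>\<^sup>+x. f (X x y (1 - s)) \<partial>lborel \<partial>lborel) = (\<integral>\<^sup>+b. \<integral>\<^sup>+a. F a b s \<partial>lborel \<partial>lborel)"
    proof (cases "s > 0")
      case True
      have "(\<integral>\<^sup>+y. \<integral>\<^sup>+x. f (X x y (1 - s)) \<partial>lborel \<partial>lborel) =
          (\<integral>\<^sup>+y. ennreal s * (\<integral>\<^sup>+a. f (X (s * a) y (1 - s)) \<partial>lborel) \<partial>lborel)"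
        using True by (intro nn_integral_cong nn_integral_scale) measurable
      also have "\<dots> = ennreal s * (\<integral>\<^sup>+b. ennreal s * (\<integral>\<^sup>+a. f (X (s * a) (s * b) (1 - s)) \<partial>lborel) \<partial>lborel)"
        using True by (intro nn_integral_scale) measurable
      also have "\<dots> = (\<integral>\<^sup>+b. \<integral>\<^sup>+a. ennreal s * (ennreal s * f (X (s * a) (s * b) (1 - s))) \<partial>lborel \<partial>lborel)"
        proof -
        have "(\<integral>\<^sup>+a. ennreal s * (ennreal s * f (X (s * a) (s * b) (1 - s))) \<partial>lborel) =
            ennreal s * (ennreal s * (\<integral>\<^sup>+a. f (X (s * a) (s * b) (1 - s)) \<partial>lborel))" for b
          by (simp add: nn_integral_cmult)
        then show ?thesis by (simp, intro nn_integral_cmult[symmetric]) measurable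
      qed
      finally show ?thesis using True by (simp add: scale)
    qed (simp add: zero)
  qed
  \<comment> \<open>Three exchanges bring \<open>s\<close> innermost, so that each geodesic to the
    ideal point is integrated first.\<close>
  also have "\<dots> = (\<integral>\<^sup>+b. \<integral>\<^sup>+s. \<integral>\<^sup>+a. F a b s \<partial>lborel \<partial>lborel \<partial>lborel)"
    by (rule nn_integral_lborel_swap) measurable
  also have "\<dots> = (\<integral>\<^sup>+b. \<integral>\<^sup>+a. \<integral>\<^sup>+s. F a b s \<partial>lborel \<partial>lborel \<partial>lborel)"
    by (intro nn_integral_cong nn_integral_lborel_swap) measurable
  also have "\<dots> = (\<integral>\<^sup>+a. \<integral>\<^sup>+b. \<integral>\<^sup>+s. F a b s \<partial>lborel \<partial>lborel \<partial>lborel)"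
    by (rule nn_integral_lborel_swap) measurable
  finally show ?thesis unfolding F_def X_def .
qed

lemma nn_integral_FTC_Ioc:
  fixes f :: "real \<Rightarrow> real"
  assumes "f \<in> borel_measurable borel"
    and "\<And>x. x \<in> {a..b} \<Longrightarrow> DERIV F x :> f x" "\<And>x. x \<in> {a..b} \<Longrightarrow> 0 \<le> f x" "a \<le> b"
  shows "(\<integral>\<^sup>+x. indicator {a<..b} x * ennreal (f x) \<partial>lborel) = ennreal (F b - F a)"
proof -
  have "(\<integral>\<^sup>+x. indicator {a<..b} x * ennreal (f x) \<partial>lborel) =
      (\<integral>\<^sup>+x. ennreal (f x) * indicator {a..b} x \<partial>lborel)"
    by (intro nn_integral_cong_AE eventually_mono[OF AE_lborel_singleton[of a]])
      (auto simp: indicator_def)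
  also have "\<dots> = ennreal (F b - F a)" by (rule nn_integral_FTC_Icc) (use assms in auto)
  finally show ?thesis .
qed

lemma vertical_integral:
  fixes q S :: real
  assumes "q > 0" "S \<ge> 0" "S * q < 2"
  shows "(\<integral>\<^sup>+s. indicator {0<..S} s * ennreal (1 / (2 - s * q)\<^sup>2) \<partial>lborel) =
    ennreal (S / (2 * (2 - S * q)))"
proof -
  have *: "2 - s * q > 0" if "s \<in> {0..S}" for s
  proof -
    have "s * q \<le> S * q" using that assms by (intro mult_right_mono) auto
    then show ?thesis using assms by linarith
  qed
  have "(\<integral>\<^sup>+s. indicator {0<..S} s * ennreal (1 / (2 - s * q)\<^sup>2) \<partial>lborel) =
      ennreal (1 / (q * (2 - S * q)) - 1 / (q * (2 - 0 * q)))"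
  proof (rule nn_integral_FTC_Ioc)
    fix s assume "s \<in> {0..S}"
    from *[OF this] show "DERIV (\<lambda>s. 1 / (q * (2 - s * q))) s :> 1 / (2 - s * q)\<^sup>2"
      using assms by (auto intro!: derivative_eq_intros simp: divide_simps power2_eq_square)
  qed (use assms in auto)
  also have "1 / (q * (2 - S * q)) - 1 / (q * (2 - 0 * q)) = S / (2 * (2 - S * q))"
    using *[of S] assms by (simp add: divide_simps)
  finally show ?thesis .
qed

lemma nn_integral_even:
  fixes f :: "real \<Rightarrow> ennreal"
  assumes [measurable]: "f \<in> borel_measurable borel"
  shows "(\<integral>\<^sup>+a. f \<bar>a\<bar> \<partial>lborel) = 2 * (\<integral>\<^sup>+a. indicator {0<..} a * f a \<partial>lborel)"
proof -
  have "(\<integral>\<^sup>+a. f \<bar>a\<bar> \<partial>lborel) = (\<integral>\<^sup>+a. indicator {0<..} a * f a + indicator {..<0} a * f (- a) \<partial>lborel)"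
    by (intro nn_integral_cong_AE eventually_mono[OF AE_lborel_singleton[of 0]]) (auto simp: indicator_def)
  also have "\<dots> = (\<integral>\<^sup>+a. indicator {0<..} a * f a \<partial>lborel) + (\<integral>\<^sup>+a. indicator {..<0} a * f (- a) \<partial>lborel)"
    by (rule nn_integral_add) measurable
  also have "(\<integral>\<^sup>+a. indicator {..<0} a * f (- a) \<partial>lborel) = (\<integral>\<^sup>+a. indicator {0<..} a * f a \<partial>lborel)"
    using nn_integral_real_affine[of "\<lambda>a. indicator {..<0} a * f (- a)" "-1" 0]
    by (simp add: indicator_def)
  finally show ?thesis by (simp add: mult_2)
qed

text \<open>With \<open>m = |a| + |b|\<close> the octahedron is given by
  \<open>s * m + |1 - s| \<le> 1\<close>. This says \<open>m \<le> 1\<close> for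
  \<open>s \<le> 1\<close> and \<open>s * (1 + m) \<le> 2\<close> for \<open>s \<ge> 1\<close>, and
  in each range the other inequality follows. The facets at the ideal point thus become the vertical
  walls over the square \<open>m \<le> 1\<close>, and the other four form the floor. The horoball is
  the set where the squared height is at least \<open>1 / w\<close>.\<close>

lemma cone_mem:
  fixes j k l :: 3 and e s a b :: real
  assumes jkl: "j \<noteq> k" "j \<noteq> l" "k \<noteq> l" and e: "e \<in> {1, -1}" and s: "s > 0"
  defines "x \<equiv> (s * a) *\<^sub>R axis j e + (s * b) *\<^sub>R axis k e + (1 - s) *\<^sub>R (axis l e :: real ^ 3)"
  shows "x \<in> hyp_space \<longleftrightarrow> s * (1 + a\<^sup>2 + b\<^sup>2) < 2"
    and "\<bar>x $ 1\<bar> + \<bar>x $ 2\<bar> + \<bar>x $ 3\<bar> \<le> 1 \<longleftrightarrow> \<bar>a\<bar> + \<bar>b\<bar> \<le> 1 \<and> s * (1 + \<bar>a\<bar> + \<bar>b\<bar>) \<le> 2"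
    and "w > 0 \<Longrightarrow> x \<in> hyp_space \<and> (1 - x \<bullet> axis l e)\<^sup>2 \<le> w * (1 - x \<bullet> x) \<longleftrightarrow> s * (1 + a\<^sup>2 + b\<^sup>2 + 1 / w) \<le> 2"
proof -
  note xx = cone_inner[OF jkl e x_def[THEN meta_eq_to_obj_eq]]
  have hyp: "x \<in> hyp_space \<longleftrightarrow> x \<bullet> x < 1"
    by (simp add: hyp_space_def dot_square_norm abs_square_less_1)
  also have "\<dots> \<longleftrightarrow> 0 < s * (2 - s * (1 + a\<^sup>2 + b\<^sup>2))" unfolding xx(1)[symmetric] by simp
  also have "\<dots> \<longleftrightarrow> s * (1 + a\<^sup>2 + b\<^sup>2) < 2" using s by (simp add: zero_less_mult_iff)
  finally show hs: "x \<in> hyp_space \<longleftrightarrow> s * (1 + a\<^sup>2 + b\<^sup>2) < 2" .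
  have jkl': "UNIV = {j, k, l}"
  proof -
    have "card {j, k, l} = CARD(3)" using jkl by simp
    then show ?thesis by (metis card_subset_eq finite subset_UNIV)
  qed
  have ae: "\<bar>c * e\<bar> = \<bar>c\<bar>" for c using e by auto
  have "\<bar>x $ 1\<bar> + \<bar>x $ 2\<bar> + \<bar>x $ 3\<bar> = (\<Sum>i\<in>UNIV. \<bar>x $ i\<bar>)" by (simp add: sum_3)
  also have "\<dots> = \<bar>s * a\<bar> + (\<bar>s * b\<bar> + \<bar>1 - s\<bar>)"
    unfolding jkl' using jkl by (simp add: x_def axis_def ae)
  also have "\<dots> = s * (\<bar>a\<bar> + \<bar>b\<bar>) + \<bar>1 - s\<bar>" using s by (simp add: abs_mult algebra_simps)
  finally have eq: "\<bar>x $ 1\<bar> + \<bar>x $ 2\<bar> + \<bar>x $ 3\<bar> = s * (\<bar>a\<bar> + \<bar>b\<bar>) + \<bar>1 - s\<bar>" .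
  define m where "m = \<bar>a\<bar> + \<bar>b\<bar>"
  have "s * m + \<bar>1 - s\<bar> \<le> 1 \<longleftrightarrow> m \<le> 1 \<and> s * (1 + m) \<le> 2"
  proof (cases "s \<le> 1")
    case True
    have "s * m \<le> s \<longleftrightarrow> m \<le> 1" using s mult_le_cancel_left_pos[of s m 1] by simp
    moreover have "s * m \<le> 1" if "m \<le> 1"
    proof -
      have "s * m \<le> s * 1" using that s by (intro mult_left_mono) auto
      then show ?thesis using True by linarith
    qed
    ultimately show ?thesis using True by (auto simp: distrib_left)
  next
    case False
    have "m \<le> 1" if "s * m \<le> 2 - s"
    proof -
      have "s * m \<le> s * 1" using that False by linarith
      then show ?thesis using s by simp
    qed
    then show ?thesis using False by (auto simp: distrib_left)
  qed
  then show "\<bar>x $ 1\<bar> + \<bar>x $ 2\<bar> + \<bar>x $ 3\<bar> \<le> 1 \<longleftrightarrow> \<bar>a\<bar> + \<bar>b\<bar> \<le> 1 \<and> s * (1 + \<bar>a\<bar> + \<bar>b\<bar>) \<le> 2"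
    unfolding eq by (simp add: m_def add.assoc)
  assume w: "w > 0"
  have "(1 - x \<bullet> axis l e)\<^sup>2 \<le> w * (1 - x \<bullet> x) \<longleftrightarrow> s * s \<le> s * (w * (2 - s * (1 + a\<^sup>2 + b\<^sup>2)))"
    unfolding xx by (simp add: power2_eq_square mult.left_commute)
  also have "\<dots> \<longleftrightarrow> s \<le> w * (2 - s * (1 + a\<^sup>2 + b\<^sup>2))" using s by simp
  also have "\<dots> \<longleftrightarrow> s / w \<le> 2 - s * (1 + a\<^sup>2 + b\<^sup>2)" using w by (simp add: pos_divide_le_eq mult.commute)
  also have "\<dots> \<longleftrightarrow> s * (1 + a\<^sup>2 + b\<^sup>2 + 1 / w) \<le> 2" by (auto simp: algebra_simps)
  finally have "(1 - x \<bullet> axis l e)\<^sup>2 \<le> w * (1 - x \<bullet> x) \<longleftrightarrow> s * (1 + a\<^sup>2 + b\<^sup>2 + 1 / w) \<le> 2" .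
  moreover have "s * (1 + a\<^sup>2 + b\<^sup>2) < 2" if "s * (1 + a\<^sup>2 + b\<^sup>2 + 1 / w) \<le> 2"
  proof -
    have "s * (1 + a\<^sup>2 + b\<^sup>2 + 1 / w) = s * (1 + a\<^sup>2 + b\<^sup>2) + s / w" by (simp add: algebra_simps)
    moreover have "s / w > 0" using s w by simp
    ultimately show ?thesis using that by linarith
  qed
  ultimately show "x \<in> hyp_space \<and> (1 - x \<bullet> axis l e)\<^sup>2 \<le> w * (1 - x \<bullet> x) \<longleftrightarrow> s * (1 + a\<^sup>2 + b\<^sup>2 + 1 / w) \<le> 2"
    using hs by blast
qed

lemma square_area:
  "(\<integral>\<^sup>+a. \<integral>\<^sup>+b. indicator {..1} (\<bar>a\<bar> + \<bar>b :: real\<bar>) \<partial>lborel \<partial>lborel) = (2 :: ennreal)"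
proof -
  have 1: "(\<integral>\<^sup>+b. indicator {..1} (a + \<bar>b\<bar>) \<partial>lborel) = ennreal (2 * (1 - a)) * indicator {..1} a" for a :: real
  proof -
    have "(\<integral>\<^sup>+b. indicator {..1} (a + \<bar>b\<bar>) \<partial>lborel) = (\<integral>\<^sup>+b. indicator {-(1 - a)..1 - a} b \<partial>lborel)"
      by (intro nn_integral_cong) (auto simp: indicator_def)
    also have "\<dots> = emeasure lborel {-(1 - a)..1 - a}" by simp
    also have "\<dots> = ennreal (2 * (1 - a)) * indicator {..1} a"
      by (cases "a \<le> 1") auto
    finally show ?thesis .
  qed
  have "(\<integral>\<^sup>+a. \<integral>\<^sup>+b. indicator {..1} (\<bar>a\<bar> + \<bar>b :: real\<bar>) \<partial>lborel \<partial>lborel) =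
      (\<integral>\<^sup>+a. ennreal (2 * (1 - \<bar>a\<bar>)) * indicator {..1} \<bar>a\<bar> \<partial>lborel)"
    unfolding 1 ..
  also have "\<dots> = 2 * (\<integral>\<^sup>+a. indicator {0<..} a * (ennreal (2 * (1 - a)) * indicator {..1} a) \<partial>lborel)"
    by (rule nn_integral_even) measurable
  also have "(\<integral>\<^sup>+a. indicator {0<..} a * (ennreal (2 * (1 - a)) * indicator {..1} a) \<partial>lborel) =
      (\<integral>\<^sup>+a. indicator {0<..1} a * ennreal (2 * (1 - a)) \<partial>lborel)"
    by (intro nn_integral_cong) (auto simp: indicator_def)
  also have "\<dots> = ennreal ((\<lambda>a. 2 * a - a\<^sup>2) 1 - (\<lambda>a. 2 * a - a\<^sup>2) 0)"
    by (rule nn_integral_FTC_Ioc) (auto intro!: derivative_eq_intros)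
  finally show ?thesis by simp
qed

text \<open>Above every base point the vertical integral is \<open>w / 2\<close>, and the base
  square has area 2. The floor of the cell does not interfere for \<open>w \<le> 2\<close>, because
  \<open>a^2 + b^2 + 1 / w - |a| - |b|\<close> is then at least
  \<open>(|a| - 1/2)^2 + (|b| - 1/2)^2\<close>.\<close>

lemma emeasure_cusp:
  fixes j k l :: 3 and e w :: real
  assumes jkl: "j \<noteq> k" "j \<noteq> l" "k \<noteq> l" and e: "e \<in> {1, -1}" and w: "0 < w" "w \<le> 2"
  shows "emeasure hyp_measure {x \<in> hyp_space. (1 - x \<bullet> axis l e)\<^sup>2 \<le> w * (1 - x \<bullet> x) \<and>
    \<bar>x $ 1\<bar> + \<bar>x $ 2\<bar> + \<bar>x $ 3\<bar> \<le> 1} = ennreal w" (is "emeasure _ ?A = _")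
proof -
  define X where "X s a b = (s * a) *\<^sub>R axis j e + (s * b) *\<^sub>R axis k e + (1 - s) *\<^sub>R (axis l e :: real ^ 3)" for s a b
  define S where "S a b = 2 / (1 + a\<^sup>2 + b\<^sup>2 + 1 / w)" for a b
  have pos: "1 + a\<^sup>2 + b\<^sup>2 + 1 / w > 0" for a b :: real
    using w by (intro add_nonneg_pos) auto
  have mem: "X s a b \<in> ?A \<longleftrightarrow> \<bar>a\<bar> + \<bar>b\<bar> \<le> 1 \<and> s \<le> S a b" if "s > 0" for s a b
  proof -
    note cm = cone_mem(2)[OF jkl e that, of a b, folded X_def]
      cone_mem(3)[OF jkl e that w(1), of a b, folded X_def]
    have "X s a b \<in> ?A \<longleftrightarrow> s * (1 + a\<^sup>2 + b\<^sup>2 + 1 / w) \<le> 2 \<and> \<bar>a\<bar> + \<bar>b\<bar> \<le> 1 \<and> s * (1 + \<bar>a\<bar> + \<bar>b\<bar>) \<le> 2"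
      using cm by auto
    moreover have "s * (1 + \<bar>a\<bar> + \<bar>b\<bar>) \<le> 2" if "s * (1 + a\<^sup>2 + b\<^sup>2 + 1 / w) \<le> 2"
    proof -
      have "0 \<le> (\<bar>a\<bar> - 1 / 2)\<^sup>2 + (\<bar>b\<bar> - 1 / 2)\<^sup>2" by simp
      also have "\<dots> = a\<^sup>2 + b\<^sup>2 + 1 / 2 - \<bar>a\<bar> - \<bar>b\<bar>" by (simp add: power2_eq_square algebra_simps)
      also have "\<dots> \<le> a\<^sup>2 + b\<^sup>2 + 1 / w - \<bar>a\<bar> - \<bar>b\<bar>" using w by (simp add: field_simps)
      finally have "1 + \<bar>a\<bar> + \<bar>b\<bar> \<le> 1 + a\<^sup>2 + b\<^sup>2 + 1 / w" by simp
      then have "s * (1 + \<bar>a\<bar> + \<bar>b\<bar>) \<le> s * (1 + a\<^sup>2 + b\<^sup>2 + 1 / w)"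
        using \<open>s > 0\<close> by (intro mult_left_mono) auto
      with that show ?thesis by linarith
    qed
    ultimately show ?thesis using pos[of a b] by (auto simp: S_def pos_le_divide_eq)
  qed
  have A: "?A \<in> sets borel" unfolding hyp_space_def by measurable
  have "emeasure hyp_measure ?A = (\<integral>\<^sup>+a. \<integral>\<^sup>+b. \<integral>\<^sup>+s.
      indicator {0<..} s * indicator ?A (X s a b) * ennreal (1 / (2 - s * (1 + a\<^sup>2 + b\<^sup>2))\<^sup>2) \<partial>lborel \<partial>lborel \<partial>lborel)"
    unfolding X_def by (rule emeasure_hyp_cone[OF jkl e A]) auto
  also have "\<dots> = (\<integral>\<^sup>+a. \<integral>\<^sup>+b. indicator {..1} (\<bar>a\<bar> + \<bar>b :: real\<bar>) * ennreal (w / 2) \<partial>lborel \<partial>lborel)"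
  proof (intro nn_integral_cong)
    fix a b :: real
    define q where "q = 1 + a\<^sup>2 + b\<^sup>2"
    have q: "q > 0" by (simp add: q_def add_pos_nonneg)
    have S: "S a b = 2 / (q + 1 / w)" by (simp add: S_def q_def)
    have qw: "q + 1 / w > 0" using q w by (simp add: add_pos_pos)
    have S2: "2 - S a b * q = (2 / w) / (q + 1 / w)" unfolding S using qw by (simp add: field_simps)
    have "(\<integral>\<^sup>+s. indicator {0<..} s * indicator ?A (X s a b) * ennreal (1 / (2 - s * q)\<^sup>2) \<partial>lborel) =
        (\<integral>\<^sup>+s. indicator {..1} (\<bar>a\<bar> + \<bar>b\<bar>) * (indicator {0<..S a b} s * ennreal (1 / (2 - s * q)\<^sup>2)) \<partial>lborel)"
      using mem by (intro nn_integral_cong) (auto simp: indicator_def)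
    also have "\<dots> = indicator {..1} (\<bar>a\<bar> + \<bar>b\<bar>) * (\<integral>\<^sup>+s. indicator {0<..S a b} s * ennreal (1 / (2 - s * q)\<^sup>2) \<partial>lborel)"
      by (rule nn_integral_cmult) measurable
    also have "(\<integral>\<^sup>+s. indicator {0<..S a b} s * ennreal (1 / (2 - s * q)\<^sup>2) \<partial>lborel) = ennreal (S a b / (2 * (2 - S a b * q)))"
    proof (rule vertical_integral)
      have "0 < 2 - S a b * q" unfolding S2 using qw w by simp
      then show "S a b * q < 2" by simp
    qed (use q qw in \<open>auto simp: S\<close>)
    also have "S a b / (2 * (2 - S a b * q)) = w / 2"
      unfolding S2 unfolding S using qw w by (simp add: field_simps)
    finally show "(\<integral>\<^sup>+s. indicator {0<..} s * indicator ?A (X s a b) * ennreal (1 / (2 - s * (1 + a\<^sup>2 + b\<^sup>2))\<^sup>2) \<partial>lborel) =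
        indicator {..1} (\<bar>a\<bar> + \<bar>b\<bar>) * ennreal (w / 2)" unfolding q_def .
  qed
  also have "\<dots> = (\<integral>\<^sup>+a. \<integral>\<^sup>+b. indicator {..1} (\<bar>a\<bar> + \<bar>b :: real\<bar>) \<partial>lborel \<partial>lborel) * ennreal (w / 2)"
    by (simp add: nn_integral_multc)
  also have "\<dots> = ennreal 2 * ennreal (w / 2)" unfolding square_area by simp
  also have "\<dots> = ennreal w" using w by (subst ennreal_mult[symmetric]) auto
  finally show ?thesis .
qed

section \<open>Reduction of the cell volume to a one-dimensional integral\<close>

text \<open>By symmetry the half of the quadrant below the diagonal suffices; there
  \<open>b = a * t\<close> with slope \<open>t\<close> between 0 and 1 and Jacobian
  \<open>a\<close>. This Jacobian cancels the factor \<open>1 / a\<close> that the vertical integral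
  of the cell produces.\<close>

lemma nn_integral_quadrant:
  fixes G :: "real \<Rightarrow> real \<Rightarrow> ennreal"
  assumes G: "(\<lambda>(a, b). G a b) \<in> borel_measurable (borel \<Otimes>\<^sub>M borel)"
    and sym: "\<And>a b. G a b = G b a"
  shows "(\<integral>\<^sup>+a. \<integral>\<^sup>+b. indicator {0<..} a * indicator {0<..} b * G a b \<partial>lborel \<partial>lborel) =
    2 * (\<integral>\<^sup>+t. indicator {0<..<1} t * (\<integral>\<^sup>+a. indicator {0<..} a * (ennreal a * G a (a * t)) \<partial>lborel) \<partial>lborel)"
proof -
  have Gm [measurable (raw)]: "(\<lambda>p. G (f p) (g p)) \<in> borel_measurable M"
    if [measurable]: "f \<in> borel_measurable M" "g \<in> borel_measurable M"
    for f g :: "'b \<Rightarrow> real" and M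
    using measurable_compose[OF _ G, of "\<lambda>p. (f p, g p)" M] by simp
  define K where "K a b = (if 0 < b \<and> b < a then G a b else 0)" for a b
  have [measurable (raw)]: "(\<lambda>p. K (f p) (g p)) \<in> borel_measurable M"
    if [measurable]: "f \<in> borel_measurable M" "g \<in> borel_measurable M"
    for f g :: "'b \<Rightarrow> real" and M
    unfolding K_def by measurable
  define L where "L = (\<integral>\<^sup>+a. \<integral>\<^sup>+b. K a b \<partial>lborel \<partial>lborel)"
  have "(\<integral>\<^sup>+a. \<integral>\<^sup>+b. indicator {0<..} a * indicator {0<..} b * G a b \<partial>lborel \<partial>lborel) =
      (\<integral>\<^sup>+a. \<integral>\<^sup>+b. K a b + K b a \<partial>lborel \<partial>lborel)"
  proof (rule nn_integral_cong, rule nn_integral_cong_AE)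
    fix a :: real
    show "AE b in lborel. indicator {0<..} a * indicator {0<..} b * G a b =
        K a b + K b a"
      \<comment> \<open>On the diagonal \<open>b = a\<close> both copies of \<open>K\<close> vanish,
        but it meets each line in one point only.\<close>
      by (intro eventually_mono[OF AE_lborel_singleton[of a]]) (auto simp: indicator_def K_def sym[of a])
  qed
  also have "\<dots> = (\<integral>\<^sup>+a. (\<integral>\<^sup>+b. K a b \<partial>lborel)
        + (\<integral>\<^sup>+b. K b a \<partial>lborel) \<partial>lborel)"
    by (rule nn_integral_cong, rule nn_integral_add) measurable
  also have "\<dots> = L + (\<integral>\<^sup>+a. \<integral>\<^sup>+b. K b a \<partial>lborel \<partial>lborel)"
    unfolding L_def by (rule nn_integral_add) measurable
  also have "(\<integral>\<^sup>+a. \<integral>\<^sup>+b. K b a \<partial>lborel \<partial>lborel) = L"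
    unfolding L_def by (rule nn_integral_lborel_swap) measurable
  also have "L + L = 2 * L" by (simp add: mult_2)
  also have "L = (\<integral>\<^sup>+a. \<integral>\<^sup>+t. indicator {0<..<1} t * (indicator {0<..} a * (ennreal a * G a (a * t))) \<partial>lborel \<partial>lborel)"
    unfolding L_def
  proof (rule nn_integral_cong)
    fix a :: real
    show "(\<integral>\<^sup>+b. K a b \<partial>lborel) =
        (\<integral>\<^sup>+t. indicator {0<..<1} t * (indicator {0<..} a * (ennreal a * G a (a * t))) \<partial>lborel)"
    proof (cases "a > 0")
      case True
      have "(\<integral>\<^sup>+b. K a b \<partial>lborel) =
          ennreal a * (\<integral>\<^sup>+t. K a (a * t) \<partial>lborel)"
        by (rule nn_integral_scale[OF _ True]) measurable
      also have "\<dots> = (\<integral>\<^sup>+t. ennreal a * (K a (a * t)) \<partial>lborel)"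
        by (rule nn_integral_cmult[symmetric]) measurable
      also have "\<dots> = (\<integral>\<^sup>+t. indicator {0<..<1} t * (indicator {0<..} a * (ennreal a * G a (a * t))) \<partial>lborel)"
        using True by (intro nn_integral_cong) (auto simp: indicator_def K_def zero_less_mult_iff)
      finally show ?thesis .
    next
      case False
      then have "K a b = 0" for b by (auto simp: K_def)
      then show ?thesis using False by simp
    qed
  qed
  also have "\<dots> = (\<integral>\<^sup>+t. \<integral>\<^sup>+a. indicator {0<..<1} t * (indicator {0<..} a * (ennreal a * G a (a * t))) \<partial>lborel \<partial>lborel)"
    by (rule nn_integral_lborel_swap) measurable
  also have "\<dots> = (\<integral>\<^sup>+t. indicator {0<..<1} t * (\<integral>\<^sup>+a. indicator {0<..} a * (ennreal a * G a (a * t)) \<partial>lborel) \<partial>lborel)"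
    by (rule nn_integral_cong, rule nn_integral_cmult) measurable
  finally show ?thesis .
qed

text \<open>The upper limit \<open>1 / (1 + t)\<close> is where the ray of slope \<open>t\<close>
  leaves the triangle \<open>a + b \<le> 1\<close>. The denominator decreases along the ray and is
  still positive there, by \<open>end_eq\<close>, so the logarithm is an antiderivative on the whole
  interval.\<close>

lemma slope_integral:
  fixes t :: real
  assumes t: "0 < t" "t < 1"
  shows "(\<integral>\<^sup>+a. indicator {0<..1 / (1 + t)} a * ennreal (1 / (2 * ((1 + t) - a * (1 + t\<^sup>2)))) \<partial>lborel) =
    ennreal (ln ((1 + t)\<^sup>2 / (2 * t)) / (2 * (1 + t\<^sup>2)))"
proof -
  define c where "c = 1 + t\<^sup>2"
  have c: "c > 0" by (simp add: c_def add_pos_nonneg)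
  have end_eq: "(1 + t) - (1 / (1 + t)) * c = 2 * t / (1 + t)"
    using t by (simp add: c_def field_simps power2_eq_square)
  have pos: "(1 + t) - a * c > 0" if "a \<in> {0..1 / (1 + t)}" for a
  proof -
    have "a * c \<le> (1 / (1 + t)) * c" using that c by (intro mult_right_mono) auto
    moreover have "2 * t / (1 + t) > 0" using t by simp
    ultimately show ?thesis using end_eq by linarith
  qed
  have "(\<integral>\<^sup>+a. indicator {0<..1 / (1 + t)} a * ennreal (1 / (2 * ((1 + t) - a * c))) \<partial>lborel) =
      ennreal ((- ln ((1 + t) - (1 / (1 + t)) * c) / (2 * c)) - (- ln ((1 + t) - 0 * c) / (2 * c)))"
  proof (rule nn_integral_FTC_Ioc)
    fix a assume a: "a \<in> {0..1 / (1 + t)}"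
    show "DERIV (\<lambda>a. - ln ((1 + t) - a * c) / (2 * c)) a :> 1 / (2 * ((1 + t) - a * c))"
      using pos[OF a] c by (auto intro!: derivative_eq_intros simp: divide_simps)
    show "0 \<le> 1 / (2 * ((1 + t) - a * c))" using pos[OF a] by simp
  qed (use t in auto)
  also have "(- ln ((1 + t) - (1 / (1 + t)) * c) / (2 * c)) - (- ln ((1 + t) - 0 * c) / (2 * c)) =
      (ln (1 + t) - ln (2 * t / (1 + t))) / (2 * c)"
    unfolding end_eq by (simp add: diff_divide_distrib)
  also have "ln (1 + t) - ln (2 * t / (1 + t)) = ln ((1 + t)\<^sup>2 / (2 * t))"
    using t by (simp add: ln_div ln_mult power2_eq_square)
  finally show ?thesis unfolding c_def .
qed

text \<open>In the first quadrant the floor is \<open>s = 2 / (1 + a + b)\<close>, and the vertical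
  integral up to it equals \<open>1 / (2 * (a + b - a^2 - b^2))\<close>. On the ray
  \<open>b = a * t\<close> the bracket is \<open>a * ((1 + t) - a * (1 + t^2))\<close>, so after
  cancelling \<open>a\<close> the integrand is the one of \<open>slope_integral\<close>.\<close>

lemma emeasure_octahedron:
  "emeasure hyp_measure {x \<in> hyp_space. \<bar>x $ 1\<bar> + \<bar>x $ 2\<bar> + \<bar>x $ 3\<bar> \<le> 1} =
    (\<integral>\<^sup>+t. ennreal (4 * ln ((1 + t)\<^sup>2 / (2 * t)) / (1 + t\<^sup>2)) * indicator {0<..<1} t \<partial>lborel)"
    (is "emeasure _ ?A = _")
proof -
  define X where "X s a b = (s * a) *\<^sub>R axis 1 1 + (s * b) *\<^sub>R axis 2 1 + (1 - s) *\<^sub>R (axis 3 1 :: real ^ 3)" for s a b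
  define H where "H a b s = (if 0 < s \<and> a + b \<le> 1 \<and> s * (1 + a + b) \<le> 2 \<and> s * (1 + a\<^sup>2 + b\<^sup>2) < 2
      then ennreal (1 / (2 - s * (1 + a\<^sup>2 + b\<^sup>2))\<^sup>2) else 0)" for a b s :: real
  define G where "G a b = (\<integral>\<^sup>+s. H a b s \<partial>lborel)" for a b
  have Hm [measurable (raw)]: "(\<lambda>p. H (f p) (g p) (h p)) \<in> borel_measurable M"
    if [measurable]: "f \<in> borel_measurable M" "g \<in> borel_measurable M" "h \<in> borel_measurable M"
    for f g h :: "'b \<Rightarrow> real" and M
    unfolding H_def by measurable
  have Gm [measurable (raw)]: "(\<lambda>p. G (f p) (g p)) \<in> borel_measurable M"
    if [measurable]: "f \<in> borel_measurable M" "g \<in> borel_measurable M"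
    for f g :: "'b \<Rightarrow> real" and M
    unfolding G_def by measurable
  have A: "?A \<in> sets borel" unfolding hyp_space_def by measurable
  have dist: "(1 :: 3) \<noteq> 2" "(1 :: 3) \<noteq> 3" "(2 :: 3) \<noteq> 3" by auto
  have "emeasure hyp_measure ?A = (\<integral>\<^sup>+a. \<integral>\<^sup>+b. \<integral>\<^sup>+s.
      indicator {0<..} s * indicator ?A (X s a b) * ennreal (1 / (2 - s * (1 + a\<^sup>2 + b\<^sup>2))\<^sup>2) \<partial>lborel \<partial>lborel \<partial>lborel)"
    unfolding X_def by (rule emeasure_hyp_cone[OF dist _ A]) auto
  also have "\<dots> = (\<integral>\<^sup>+a. \<integral>\<^sup>+b. G \<bar>a\<bar> \<bar>b\<bar> \<partial>lborel \<partial>lborel)"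
    unfolding G_def
  proof (intro nn_integral_cong)
    fix a b s :: real
    show "indicator {0<..} s * indicator ?A (X s a b) * ennreal (1 / (2 - s * (1 + a\<^sup>2 + b\<^sup>2))\<^sup>2) = H \<bar>a\<bar> \<bar>b\<bar> s"
    proof (cases "s > 0")
      case True
      note cm = cone_mem(1,2)[OF dist, of 1 s a b, OF _ True, folded X_def]
      show ?thesis using True cm by (auto simp: H_def indicator_def)
    qed (simp add: H_def)
  qed
  also have "\<dots> = (\<integral>\<^sup>+a. 2 * (\<integral>\<^sup>+b. indicator {0<..} b * G \<bar>a\<bar> b \<partial>lborel) \<partial>lborel)"
    by (rule nn_integral_cong, rule nn_integral_even) measurable
  also have "\<dots> = 2 * (\<integral>\<^sup>+a. indicator {0<..} a * (2 * (\<integral>\<^sup>+b. indicator {0<..} b * G a b \<partial>lborel)) \<partial>lborel)"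
    by (rule nn_integral_even) measurable
  also have "(\<integral>\<^sup>+a. indicator {0<..} a * (2 * (\<integral>\<^sup>+b. indicator {0<..} b * G a b \<partial>lborel)) \<partial>lborel) =
      2 * (\<integral>\<^sup>+a. \<integral>\<^sup>+b. indicator {0<..} a * indicator {0<..} b * G a b \<partial>lborel \<partial>lborel)"
    by (simp add: nn_integral_cmult[symmetric] mult_ac)
  also have "(\<integral>\<^sup>+a. \<integral>\<^sup>+b. indicator {0<..} a * indicator {0<..} b * G a b \<partial>lborel \<partial>lborel) =
      2 * (\<integral>\<^sup>+t. indicator {0<..<1} t * (\<integral>\<^sup>+a. indicator {0<..} a * (ennreal a * G a (a * t)) \<partial>lborel) \<partial>lborel)"
  proof (rule nn_integral_quadrant)
    have "H a b s = H b a s" for a b s by (auto simp: H_def add_ac)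
    then show "G a b = G b a" for a b by (simp add: G_def)
  qed measurable
  also have "(\<integral>\<^sup>+t. indicator {0<..<1} t * (\<integral>\<^sup>+a. indicator {0<..} a * (ennreal a * G a (a * t)) \<partial>lborel) \<partial>lborel) =
     (\<integral>\<^sup>+t. indicator {0<..<1} t * ennreal (ln ((1 + t)\<^sup>2 / (2 * t)) / (2 * (1 + t\<^sup>2))) \<partial>lborel)"
  proof (rule nn_integral_cong)
    fix t :: real
    show "indicator {0<..<1} t * (\<integral>\<^sup>+a. indicator {0<..} a * (ennreal a * G a (a * t)) \<partial>lborel) =
      indicator {0<..<1} t * ennreal (ln ((1 + t)\<^sup>2 / (2 * t)) / (2 * (1 + t\<^sup>2)))"
    proof (cases "t \<in> {0<..<1}")
      case True
      then have t: "0 < t" "t < 1" by auto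
      have "(\<integral>\<^sup>+a. indicator {0<..} a * (ennreal a * G a (a * t)) \<partial>lborel) =
          (\<integral>\<^sup>+a. indicator {0<..1 / (1 + t)} a * ennreal (1 / (2 * ((1 + t) - a * (1 + t\<^sup>2)))) \<partial>lborel)"
      \<comment> \<open>The point on the wall \<open>a + b = 1\<close> is discarded; elsewhere the
        ray is strictly inside or strictly outside the triangle.\<close>
      proof (intro nn_integral_cong_AE eventually_mono[OF AE_lborel_singleton[of "1 / (1 + t)"]])
        fix a :: real assume a: "a \<noteq> 1 / (1 + t)"
        consider "a \<le> 0" | "0 < a" "a < 1 / (1 + t)" | "a > 1 / (1 + t)" using a by linarith
        then show "indicator {0<..} a * (ennreal a * G a (a * t)) =
            indicator {0<..1 / (1 + t)} a * ennreal (1 / (2 * ((1 + t) - a * (1 + t\<^sup>2))))"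
        proof cases
          case 1 then show ?thesis by simp
        next
          case 3
          then have "a + a * t > 1" using t by (simp add: pos_divide_less_eq distrib_left)
          then have "G a (a * t) = 0" by (simp add: G_def H_def)
          then show ?thesis using 3 by simp
        next
          case 2
          define b where "b = a * t"
          define q where "q = 1 + a\<^sup>2 + b\<^sup>2"
          define S where "S = 2 / (1 + a + b)"
          have ab: "a > 0" "b > 0" "a + b < 1"
            using 2 t by (auto simp: b_def pos_less_divide_eq distrib_left)
          have q: "q > 0" by (simp add: q_def add_pos_nonneg)
          have qm: "q < 1 + a + b"
          proof -
            have "a * a < a * 1" "b * b < b * 1" using ab by (intro mult_strict_left_mono; simp)+
            then show ?thesis by (simp add: q_def power2_eq_square)
          qed
          have S2: "2 - S * q = 2 * (1 + a + b - q) / (1 + a + b)"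
            using ab by (simp add: S_def field_simps)
          have Sq: "S * q < 2"
          proof -
            have "0 < 2 - S * q" unfolding S2 using ab qm by simp
            then show ?thesis by simp
          qed
          have S0: "S > 0" using ab by (simp add: S_def)
          have "G a b = (\<integral>\<^sup>+s. indicator {0<..S} s * ennreal (1 / (2 - s * q)\<^sup>2) \<partial>lborel)"
            unfolding G_def
          proof (rule nn_integral_cong)
            fix s :: real
            have "s * (1 + a + b) \<le> 2 \<longleftrightarrow> s \<le> S" using ab by (simp add: S_def pos_le_divide_eq)
            moreover have "s * q < 2" if "s \<le> S"
              using mult_right_mono[OF that, of q] q Sq by linarith
            ultimately show "H a b s = indicator {0<..S} s * ennreal (1 / (2 - s * q)\<^sup>2)"
              using ab by (auto simp: H_def q_def indicator_def)
          qed
          also have "\<dots> = ennreal (S / (2 * (2 - S * q)))"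
            using S0 Sq q by (intro vertical_integral) auto
          also have "S / (2 * (2 - S * q)) = 1 / (2 * (1 + a + b - q))"
          proof -
            have "2 / p / (2 * (2 * r / p)) = 1 / (2 * r)" if "p > 0" "r > 0" for p r :: real
              using that by (simp add: divide_simps)
            from this[of "1 + a + b" "1 + a + b - q"] show ?thesis
              unfolding S2 using ab qm by (simp add: S_def)
          qed
          finally have Gab: "G a b = ennreal (1 / (2 * (1 + a + b - q)))" .
          have "ennreal a * G a b = ennreal (a * (1 / (2 * (1 + a + b - q))))"
            unfolding Gab using ab by (subst ennreal_mult') auto
          also have "1 + a + b - q = a * ((1 + t) - a * (1 + t\<^sup>2))"
            by (simp add: q_def b_def power2_eq_square algebra_simps)
          also have "a * (1 / (2 * (a * ((1 + t) - a * (1 + t\<^sup>2))))) = 1 / (2 * ((1 + t) - a * (1 + t\<^sup>2)))"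
            using ab by simp
          finally show ?thesis using 2 by (simp add: b_def)
        qed
      qed
      also have "\<dots> = ennreal (ln ((1 + t)\<^sup>2 / (2 * t)) / (2 * (1 + t\<^sup>2)))"
        using t by (rule slope_integral)
      finally show ?thesis by simp
    qed simp
  qed
  \<comment> \<open>The three factors 2 come from the sign of \<open>a\<close>, the sign of
    \<open>b\<close> and the exchange of \<open>a\<close> and \<open>b\<close>.\<close>
  also have "2 * (2 * (2 * (\<integral>\<^sup>+t. indicator {0<..<1} t * ennreal (ln ((1 + t)\<^sup>2 / (2 * t)) / (2 * (1 + t\<^sup>2))) \<partial>lborel))) =
      ennreal 8 * (\<integral>\<^sup>+t. indicator {0<..<1} t * ennreal (ln ((1 + t)\<^sup>2 / (2 * t)) / (2 * (1 + t\<^sup>2))) \<partial>lborel)"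
    by (simp add: mult.assoc[symmetric])
  also have "\<dots> = (\<integral>\<^sup>+t. ennreal 8 * (indicator {0<..<1} t * ennreal (ln ((1 + t)\<^sup>2 / (2 * t)) / (2 * (1 + t\<^sup>2)))) \<partial>lborel)"
    by (rule nn_integral_cmult[symmetric]) measurable
  also have "\<dots> = (\<integral>\<^sup>+t. ennreal (4 * ln ((1 + t)\<^sup>2 / (2 * t)) / (1 + t\<^sup>2)) * indicator {0<..<1} t \<partial>lborel)"
  proof (rule nn_integral_cong)
    fix t :: real
    have "ennreal 8 * ennreal x = ennreal (8 * x)" for x by (rule ennreal_mult'[symmetric]) simp
    moreover have "8 * (x / (2 * y)) = 4 * x / y" for x y :: real by simp
    ultimately have "ennreal 8 * ennreal (ln ((1 + t)\<^sup>2 / (2 * t)) / (2 * (1 + t\<^sup>2))) =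
        ennreal (4 * ln ((1 + t)\<^sup>2 / (2 * t)) / (1 + t\<^sup>2))" by metis
    then show "ennreal 8 * (indicator {0<..<1} t * ennreal (ln ((1 + t)\<^sup>2 / (2 * t)) / (2 * (1 + t\<^sup>2)))) =
        ennreal (4 * ln ((1 + t)\<^sup>2 / (2 * t)) / (1 + t\<^sup>2)) * indicator {0<..<1} t"
      by (cases "t \<in> {0<..<1}") (simp_all only: indicator_simps mult_1_left mult_1_right mult_zero_left mult_zero_right not_False_eq_True not_True_eq_False)
  qed
  finally show ?thesis .
qed

section \<open>Numerical bounds for the volume of the cell\<close>

lemma continuous_on_x_ln_x: "continuous_on {0..1} (\<lambda>x :: real. x * ln x)"
proof -
  have "((\<lambda>x :: real. x * ln x) \<longlongrightarrow> 0) (at 0 within {0..1})"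
  proof -
    have "((\<lambda>x :: real. x * ln x) \<longlongrightarrow> 0) (at_right 0)" by real_asymp
    then show ?thesis by (simp add: at_within_Icc_at_right)
  qed
  then show ?thesis
    unfolding continuous_on_def
  proof (intro ballI)
    fix x :: real assume *: "((\<lambda>x :: real. x * ln x) \<longlongrightarrow> 0) (at 0 within {0..1})" "x \<in> {0..1}"
    show "((\<lambda>x. x * ln x) \<longlongrightarrow> x * ln x) (at x within {0..1})"
    proof (cases "x = 0")
      case False
      then show ?thesis using *(2) by (intro tendsto_intros) auto
    qed (use * in simp)
  qed
qed

lemma has_integral_power_ln:
  "((\<lambda>x :: real. - ln x * x ^ k) has_integral 1 / (real k + 1)\<^sup>2) {0..1}"
proof -
  define u v where "u = 1 / (real k + 1)\<^sup>2" and "v = 1 / (real k + 1)"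
  have uv: "u * (real k + 1) = v" "v * (real k + 1) = 1"
    by (simp_all add: u_def v_def power2_eq_square)
  \<comment> \<open>The logarithm is kept inside the factor \<open>x * ln x\<close>, so that
    continuity at 0 also holds for \<open>k = 0\<close>.\<close>
  define F :: "real \<Rightarrow> real" where "F x = u * x ^ Suc k - v * (x ^ k * (x * ln x))" for x
  have "((\<lambda>x. - ln x * x ^ k) has_integral (F 1 - F 0)) {0..1}"
  proof (rule fundamental_theorem_of_calculus_interior)
    show "continuous_on {0..1} F" unfolding F_def
      by (intro continuous_intros continuous_on_x_ln_x)
    fix x :: real assume x: "x \<in> {0<..<1}"
    have F: "F = (\<lambda>x. u * x ^ Suc k - v * (x ^ Suc k * ln x))"
      by (auto simp: F_def fun_eq_iff)
    have "(F has_real_derivative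
        u * ((real k + 1) * x ^ k) - v * ((real k + 1) * x ^ k * ln x + x ^ Suc k * (1 / x))) (at x)"
      unfolding F using x by (auto intro!: derivative_eq_intros simp del: power_Suc simp: add.commute)
    also have "u * ((real k + 1) * x ^ k) - v * ((real k + 1) * x ^ k * ln x + x ^ Suc k * (1 / x)) =
        (u * (real k + 1)) * x ^ k - (v * (real k + 1)) * x ^ k * ln x - v * x ^ k"
      using x by (simp add: algebra_simps)
    also have "\<dots> = - ln x * x ^ k" unfolding uv by simp
    finally show "(F has_vector_derivative - ln x * x ^ k) (at x)"
      by (simp add: has_real_derivative_iff_has_vector_derivative)
  qed simp
  then show ?thesis by (simp add: F_def u_def)
qed

text \<open>A form of Serret's integral that does not mention pi. The map
  \<open>\<phi> x = (1 - x) / (1 + x)\<close> exchanges 0 and 1, and \<open>f\<close> dx is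
  invariant under it. For an antiderivative \<open>F\<close>, the function
  \<open>F \<circ> \<phi>\<close> is therefore another one with the endpoint values exchanged, and
  the integral equals its own negative.\<close>

lemma has_integral_reflected_log:
  "((\<lambda>x :: real. (2 * ln (1 + x) - ln 2) / (1 + x\<^sup>2)) has_integral 0) {0..1}"
proof -
  define f :: "real \<Rightarrow> real" where "f x = (2 * ln (1 + x) - ln 2) / (1 + x\<^sup>2)" for x
  have nz: "1 + x\<^sup>2 \<noteq> 0" for x :: real by (metis add_eq_0_iff le_minus_one_simps(3) zero_le_power2)
  have "continuous_on {0..1} f" unfolding f_def
    by (intro continuous_intros) (use nz in auto)
  then obtain F where F: "\<And>x. x \<in> {0..1} \<Longrightarrow> (F has_vector_derivative f x) (at x within {0..1})"
    by (rule antiderivative_continuous) blast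
  define \<phi> :: "real \<Rightarrow> real" where "\<phi> x = (1 - x) / (1 + x)" for x
  have \<phi>: "\<phi> x \<in> {0..1}" if "x \<in> {0..1}" for x using that by (auto simp: \<phi>_def)
  have I1: "(f has_integral (F 1 - F 0)) {0..1}"
    by (rule fundamental_theorem_of_calculus) (use F in auto)
  have "(f has_integral (F (\<phi> 1) - F (\<phi> 0))) {0..1}"
  proof (rule fundamental_theorem_of_calculus)
    fix x :: real assume x: "x \<in> {0..1}"
    then have x1: "1 + x > 0" by auto
    have d: "(\<phi> has_vector_derivative (- 2 / (1 + x)\<^sup>2)) (at x within {0..1})"
      unfolding has_real_derivative_iff_has_vector_derivative[symmetric] \<phi>_def using x1
      by (auto intro!: derivative_eq_intros simp: power2_eq_square divide_simps)
    have "(F has_vector_derivative f (\<phi> x)) (at (\<phi> x) within \<phi> ` {0..1})"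
      using F[OF \<phi>[OF x]] by (rule has_vector_derivative_within_subset) (use \<phi> in blast)
    from vector_diff_chain_within[OF d this]
    have "(F \<circ> \<phi> has_vector_derivative (- 2 / (1 + x)\<^sup>2) * f (\<phi> x)) (at x within {0..1})" by simp
    also have "(- 2 / (1 + x)\<^sup>2) * f (\<phi> x) = f x"
    proof -
      have "1 + \<phi> x = 2 / (1 + x)" using x1 by (simp add: \<phi>_def divide_simps)
      then have "ln (1 + \<phi> x) = ln 2 - ln (1 + x)" using x1 by (simp add: ln_div)
      moreover have "1 + (\<phi> x)\<^sup>2 = 2 * (1 + x\<^sup>2) / (1 + x)\<^sup>2"
        using x1 by (simp add: \<phi>_def power_divide divide_simps) (simp add: power2_eq_square algebra_simps)
      moreover have "- 2 / d * (A / (2 * c / d)) = - A / c" if "d \<noteq> 0" for A c d :: real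
        using that by simp
      from this[of "(1 + x)\<^sup>2" "2 * (ln 2 - ln (1 + x)) - ln 2" "1 + x\<^sup>2"]
      have "- 2 / (1 + x)\<^sup>2 * ((2 * (ln 2 - ln (1 + x)) - ln 2) / (2 * (1 + x\<^sup>2) / (1 + x)\<^sup>2)) =
          (2 * ln (1 + x) - ln 2) / (1 + x\<^sup>2)"
        using x1 by simp
      ultimately show ?thesis unfolding f_def by simp
    qed
    finally show "((\<lambda>x. F (\<phi> x)) has_vector_derivative f x) (at x within {0..1})" by (simp add: o_def)
  qed simp
  then have "(f has_integral (F 0 - F 1)) {0..1}" by (simp add: \<phi>_def)
  with I1 have "F 1 - F 0 = F 0 - F 1" by (rule has_integral_unique)
  with I1 show ?thesis by (simp flip: f_def)
qed

text \<open>The coefficients come from the identity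
  \<open>1 / (1 + y) = p y + (y (1 - y) / 2)^8 / (1 + y)\<close>, in which \<open>p\<close> is a polynomial because
  \<open>(y (1 - y) / 2)^8 = 1\<close> at \<open>y = -1\<close>.\<close>

definition inv_coeffs :: "real list" where
  "inv_coeffs = [1, -1, 1, -1, 1, -1, 1, -1, 255/256, -247/256, 219/256, -163/256, 93/256,
     -37/256, 9/256, -1/256]"

lemma inv_polynomial:
  "(1 + y) * (\<Sum>k<16. inv_coeffs ! k * y ^ k) = 1 - (y * (1 - y) / 2) ^ 8"
proof -
  have 16: "{..<16 :: nat} = {0,1,2,3,4,5,6,7,8,9,10,11,12,13,14,15}" by (auto simp: lessThan_nat_numeral)
  show ?thesis unfolding 16 inv_coeffs_def
    by (simp add: field_simps eval_nat_numeral)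
qed

text \<open>The integral of \<open>- ln x\<close> times the polynomial at \<open>y = x^2\<close>,
  taken term by term. The first eight summands are those of Catalan's alternating series, the other
  eight correct its tail.\<close>

definition catalan_approx :: real where
  "catalan_approx = (\<Sum>k<16. inv_coeffs ! k / (2 * real k + 1)\<^sup>2)"

text \<open>One statement serves both bounds: \<open>c = 0\<close> yields a minorant of the volume
  integrand and \<open>c = 1 / 8^8\<close> a majorant.\<close>

lemma has_integral_approx:
  "((\<lambda>x. 4 * (2 * ln (1 + x) - ln 2) / (1 + x\<^sup>2) + 4 * (- ln x) * ((\<Sum>k<16. inv_coeffs ! k * (x\<^sup>2) ^ k) + c))
     has_integral 4 * (catalan_approx + c)) {0<..<1}"
proof -
  have "((\<lambda>x. 4 * ((2 * ln (1 + x) - ln 2) / (1 + x\<^sup>2)) +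
      (4 * (\<Sum>k<16. inv_coeffs ! k * (- ln x * x ^ (2 * k))) + (4 * c) * (- ln x * x ^ 0)))
      has_integral 4 * 0 + (4 * (\<Sum>k<16. inv_coeffs ! k * (1 / (real (2 * k) + 1)\<^sup>2)) + (4 * c) * (1 / (real 0 + 1)\<^sup>2))) {0..1}"
    by (intro has_integral_add has_integral_mult_right has_integral_sum has_integral_reflected_log
        has_integral_power_ln finite_lessThan)
  also have "4 * 0 + (4 * (\<Sum>k<16. inv_coeffs ! k * (1 / (real (2 * k) + 1)\<^sup>2)) + (4 * c) * (1 / (real 0 + 1)\<^sup>2)) =
      4 * (catalan_approx + c)"
    by (simp add: catalan_approx_def)
  also have "(\<lambda>x. 4 * ((2 * ln (1 + x) - ln 2) / (1 + x\<^sup>2)) +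
      (4 * (\<Sum>k<16. inv_coeffs ! k * (- ln x * x ^ (2 * k))) + (4 * c) * (- ln x * x ^ 0))) =
    (\<lambda>x. 4 * (2 * ln (1 + x) - ln 2) / (1 + x\<^sup>2) + 4 * (- ln x) * ((\<Sum>k<16. inv_coeffs ! k * (x\<^sup>2) ^ k) + c))"
    unfolding power_mult by (simp add: fun_eq_iff sum_distrib_left algebra_simps)
  finally show ?thesis by (simp only: has_integral_Icc_iff_Ioo)
qed

text \<open>For \<open>y = t^2\<close> the polynomial misses \<open>1 / (1 + y)\<close> by
  \<open>r / (1 + y)\<close>, which lies between 0 and \<open>1 / 8^8\<close> because
  \<open>y * (1 - y) \<le> 1/4\<close>. The minorant must also be nonnegative to serve as the
  integrand of a nonnegative integral. The summand \<open>0\<close> keeps the shape of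
  \<open>has_integral_approx\<close>.\<close>

lemma slope_integrand_bounds:
  fixes t :: real
  assumes t: "0 < t" "t < 1"
  defines "p \<equiv> \<Sum>k<16. inv_coeffs ! k * (t\<^sup>2) ^ k"
  shows "0 \<le> 4 * (2 * ln (1 + t) - ln 2) / (1 + t\<^sup>2) + 4 * (- ln t) * (p + 0)"
    and "4 * (2 * ln (1 + t) - ln 2) / (1 + t\<^sup>2) + 4 * (- ln t) * (p + 0) \<le> 4 * ln ((1 + t)\<^sup>2 / (2 * t)) / (1 + t\<^sup>2)"
    and "4 * ln ((1 + t)\<^sup>2 / (2 * t)) / (1 + t\<^sup>2) \<le> 4 * (2 * ln (1 + t) - ln 2) / (1 + t\<^sup>2) + 4 * (- ln t) * (p + 1 / 8 ^ 8)"
proof -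
  define y where "y = t\<^sup>2"
  define r where "r = (y * (1 - y) / 2) ^ 8"
  have y: "0 < y" "y < 1" using t by (auto simp: y_def power_less_one_iff)
  have c: "1 + y > 0" using y by simp
  have p: "p = (1 - r) / (1 + y)"
    using inv_polynomial[of y] c unfolding p_def y_def[symmetric] r_def by (simp add: field_simps)
  have r0: "0 \<le> r" using y by (simp add: r_def)
  have "(y - 1 / 2)\<^sup>2 \<ge> 0" by simp
  then have "y * (1 - y) / 2 \<le> 1 / 8" by (simp add: power2_eq_square algebra_simps)
  then have "r \<le> (1 / 8) ^ 8" unfolding r_def using y by (intro power_mono) auto
  then have r8: "r \<le> 1 / 8 ^ 8" by (simp add: power_divide)
  \<comment> \<open>The uniform bound on \<open>r\<close> cannot control \<open>(- ln t) * r\<close>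
    near 0; this one can, since \<open>- ln t \<le> 1 / t - 1\<close>.\<close>
  have rt: "r \<le> t / 2"
  proof -
    have "r \<le> (y * (1 - y) / 2) ^ 1"
      unfolding r_def using y \<open>y * (1 - y) / 2 \<le> 1 / 8\<close> by (intro power_decreasing) auto
    also have "\<dots> \<le> y / 2" using y by (simp add: mult_left_le)
    also have "\<dots> \<le> t / 2" using t by (simp add: y_def power2_eq_square)
    finally show ?thesis .
  qed
  have l: "- ln t > 0" using t by simp
  have L: "ln ((1 + t)\<^sup>2 / (2 * t)) = 2 * ln (1 + t) - ln 2 - ln t"
    using t by (simp add: ln_div ln_mult ln_realpow)
  have eq: "4 * (2 * ln (1 + t) - ln 2) / (1 + t\<^sup>2) + 4 * (- ln t) * (p + 0) =
      (4 * (ln ((1 + t)\<^sup>2 / (2 * t))) - 4 * (- ln t) * r) / (1 + y)"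
  proof -
    have "4 * A / d + 4 * m * ((1 - r) / d + 0) = (4 * (A + m) - 4 * m * r) / d" for A m d :: real
      by (simp add: diff_divide_distrib add_divide_distrib algebra_simps)
    from this[of "2 * ln (1 + t) - ln 2" "1 + y" "- ln t"] show ?thesis
      unfolding p L y_def[symmetric] by simp
  qed
  \<comment> \<open>The argument is at least 2 by the inequality of means. As
    \<open>ln 2 \<ge> 2/3\<close> exceeds the bound 1/2 on \<open>(- ln t) * r\<close>, the minorant
    is nonnegative.\<close>
  have "ln 2 \<le> ln ((1 + t)\<^sup>2 / (2 * t))"
  proof (subst ln_le_cancel_iff)
    have "0 \<le> (1 - t)\<^sup>2" by simp
    then show "2 \<le> (1 + t)\<^sup>2 / (2 * t)"
      using t by (simp add: pos_le_divide_eq power2_eq_square algebra_simps)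
  qed (use t in auto)
  moreover have "(- ln t) * r \<le> 1 / 2"
  proof -
    have "- ln t \<le> 1 / t - 1" using ln_le_minus_one[of "1 / t"] t by (simp add: ln_div)
    then have "(- ln t) * r \<le> (1 / t - 1) * (t / 2)" using rt l r0 by (intro mult_mono) auto
    also have "\<dots> = 1 / 2 - t / 2" using t by (simp add: field_simps)
    finally show ?thesis using t by simp
  qed
  ultimately show "0 \<le> 4 * (2 * ln (1 + t) - ln 2) / (1 + t\<^sup>2) + 4 * (- ln t) * (p + 0)"
    unfolding eq using ln2_ge_two_thirds c by (intro divide_nonneg_pos) linarith+
  show "4 * (2 * ln (1 + t) - ln 2) / (1 + t\<^sup>2) + 4 * (- ln t) * (p + 0) \<le> 4 * ln ((1 + t)\<^sup>2 / (2 * t)) / (1 + t\<^sup>2)"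
    unfolding eq unfolding y_def[symmetric] using c mult_nonneg_nonneg[of r "- ln t"] l r0 by (intro divide_right_mono) auto
  have "r / (1 + y) \<le> r / 1" using r0 y by (intro divide_left_mono) auto
  then have "1 / (1 + y) \<le> p + 1 / 8 ^ 8" unfolding p diff_divide_distrib using r8 by linarith
  then have "4 * (- ln t) * (1 / (1 + y)) \<le> 4 * (- ln t) * (p + 1 / 8 ^ 8)"
    using l by (intro mult_left_mono) auto
  moreover have "4 * ln ((1 + t)\<^sup>2 / (2 * t)) / (1 + t\<^sup>2) =
      4 * (2 * ln (1 + t) - ln 2) / (1 + t\<^sup>2) + 4 * (- ln t) * (1 / (1 + y))"
    unfolding L y_def[symmetric] by (simp add: diff_divide_distrib add_divide_distrib right_diff_distrib)
  ultimately show "4 * ln ((1 + t)\<^sup>2 / (2 * t)) / (1 + t\<^sup>2) \<le> 4 * (2 * ln (1 + t) - ln 2) / (1 + t\<^sup>2) + 4 * (- ln t) * (p + 1 / 8 ^ 8)"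
    by linarith
qed

lemma slope_integral_bounds:
  defines "V \<equiv> \<integral>\<^sup>+t. ennreal (4 * ln ((1 + t)\<^sup>2 / (2 * t)) / (1 + t\<^sup>2)) * indicator {0<..<1} t \<partial>lborel"
  shows "ennreal (4 * catalan_approx) \<le> V" "V \<le> ennreal (4 * (catalan_approx + 1 / 8 ^ 8))"
proof -
  define g where "g c x = 4 * (2 * ln (1 + x) - ln 2) / (1 + x\<^sup>2) + 4 * (- ln x) * ((\<Sum>k<16. inv_coeffs ! k * (x\<^sup>2) ^ k) + c)" for c x :: real
  have I: "(\<integral>\<^sup>+t. ennreal (g c t) * indicator {0<..<1} t \<partial>lborel) = ennreal (4 * (catalan_approx + c))"
    if "c \<in> {0, 1 / 8 ^ 8}" for c
  proof (rule nn_integral_has_integral_lebesgue')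
    show "(g c has_integral 4 * (catalan_approx + c)) {0<..<1}"
      unfolding g_def by (rule has_integral_approx)
    fix t :: real assume "t \<in> {0<..<1}"
    then have t: "0 < t" "t < 1" by auto
    have b: "0 \<le> g 0 t" unfolding g_def by (rule slope_integrand_bounds(1)[OF t])
    have b': "g 0 t \<le> g (1 / 8 ^ 8) t"
      unfolding g_def by (rule order_trans[OF slope_integrand_bounds(2,3)[OF t]])
    show "0 \<le> g c t" using that b order_trans[OF b b'] by blast
  qed
  have "(\<integral>\<^sup>+t. ennreal (g 0 t) * indicator {0<..<1} t \<partial>lborel) \<le> V"
    unfolding V_def g_def
    by (intro nn_integral_mono) (auto simp: indicator_def intro!: ennreal_leI slope_integrand_bounds(2)[simplified])
  then show "ennreal (4 * catalan_approx) \<le> V" using I[of 0] by simp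
  have "V \<le> (\<integral>\<^sup>+t. ennreal (g (1 / 8 ^ 8) t) * indicator {0<..<1} t \<partial>lborel)"
    unfolding V_def g_def
    by (intro nn_integral_mono) (auto simp: indicator_def intro!: ennreal_leI slope_integrand_bounds(3)[simplified])
  then show "V \<le> ennreal (4 * (catalan_approx + 1 / 8 ^ 8))" using I[of "1 / 8 ^ 8"] by simp
qed

text \<open>Catalan's constant is 0.91596559...; this interval is narrow enough for six decimals of
  the density.\<close>

lemma catalan_approx_bounds: "0.9159655 < catalan_approx" "catalan_approx + 1 / 8 ^ 8 < 0.9159657"
proof -
  have 16: "{..<16 :: nat} = {0,1,2,3,4,5,6,7,8,9,10,11,12,13,14,15}" by (auto simp: lessThan_nat_numeral)
  show "0.9159655 < catalan_approx" "catalan_approx + 1 / 8 ^ 8 < 0.9159657"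
    unfolding catalan_approx_def 16 inv_coeffs_def by simp_all
qed

section \<open>Arrangements as weights\<close>

lemma vertex_pair:
  assumes "i < 6" "j < 6" "i \<noteq> j"
  shows "ideal_vertex i \<bullet> ideal_vertex j = 0 \<or> ideal_vertex j = - ideal_vertex i"
  using assms unfolding less_6_iff
  by (elim insertE emptyE) (simp_all add: vertex_simps inner_axis_axis)

lemma opposite_vertex:
  assumes "i < 6"
  obtains k where "k < 6" "k \<noteq> i" "ideal_vertex k = - ideal_vertex i"
    "\<And>j. j < 6 \<Longrightarrow> j \<noteq> i \<Longrightarrow> j \<noteq> k \<Longrightarrow> ideal_vertex i \<bullet> ideal_vertex j = 0"
proof -
  \<comment> \<open>The list gives the index of the antipode of each vertex.\<close>
  define k where "k = [2, 4, 0, 5, 1, 3 :: nat] ! i"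
  have "k < 6 \<and> k \<noteq> i \<and> ideal_vertex k = - ideal_vertex i \<and>
      (\<forall>j\<in>{0, 1, 2, 3, 4, 5}. j \<noteq> i \<longrightarrow> j \<noteq> k \<longrightarrow> ideal_vertex i \<bullet> ideal_vertex j = 0)"
    using assms unfolding less_6_iff k_def
    by (elim insertE emptyE) (simp_all add: vertex_simps inner_axis_axis)
  then show ?thesis using that[of k] unfolding less_6_iff by blast
qed

lemma vertex_axis:
  assumes "i < 6"
  obtains j k l e where "j \<noteq> k" "j \<noteq> l" "k \<noteq> l" "e \<in> {1, -1}" "ideal_vertex i = axis l e"
proof -
  have neg: "- axis l 1 = (axis l (-1) :: real ^ 3)" for l
    by (simp add: vec_eq_iff axis_def)
  have "\<exists>l e. e \<in> {1, -1} \<and> ideal_vertex i = axis l e"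
    using assms unfolding less_6_iff by (elim insertE emptyE) (force simp: vertex_simps neg)+
  then obtain l e where le: "e \<in> {1, -1 :: real}" "ideal_vertex i = axis l e" by blast
  obtain j k :: 3 where "j \<noteq> k" "j \<noteq> l" "k \<noteq> l"
  proof (cases "l = 1")
    case True then show ?thesis using that[of 2 3] by simp
  next
    case False then show ?thesis using that[of 1 2] that[of 1 3] by (cases "l = 2") auto
  qed
  then show ?thesis using le that by blast
qed

lemma horoball_cell_volume:
  assumes "i < 6" "0 < w" "w \<le> 2"
  shows "hyp_vol (horoball (ideal_vertex i) w \<inter> P344) = w"
proof -
  obtain j k l e where jkl: "j \<noteq> k" "j \<noteq> l" "k \<noteq> l" "e \<in> {1, -1}" "ideal_vertex i = axis l e"
    using assms(1) by (rule vertex_axis)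
  have "horoball (ideal_vertex i) w \<inter> P344 = {x \<in> hyp_space. (1 - x \<bullet> axis l e)\<^sup>2 \<le> w * (1 - x \<bullet> x) \<and>
      \<bar>x $ 1\<bar> + \<bar>x $ 2\<bar> + \<bar>x $ 3\<bar> \<le> 1}"
    by (auto simp: horoball_def P344_def octahedron_eq jkl(5))
  then have "emeasure hyp_measure (horoball (ideal_vertex i) w \<inter> P344) = ennreal w"
    using emeasure_cusp[OF jkl(1-4) assms(2,3)] by simp
  then show ?thesis using assms by (simp add: hyp_vol_def measure_def)
qed

lemma cell_volume_bounds: "3.663862 < hyp_vol P344" "hyp_vol P344 < 3.6638628"
proof -
  have eq: "P344 = {x \<in> hyp_space. \<bar>x $ 1\<bar> + \<bar>x $ 2\<bar> + \<bar>x $ 3\<bar> \<le> 1}"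
    by (auto simp: P344_def octahedron_eq)
  have lo: "ennreal (4 * catalan_approx) \<le> emeasure hyp_measure P344"
    and hi: "emeasure hyp_measure P344 \<le> ennreal (4 * (catalan_approx + 1 / 8 ^ 8))"
    unfolding eq emeasure_octahedron by (rule slope_integral_bounds)+
  \<comment> \<open>Finiteness has to come first: the real-valued measure of a set of infinite
    measure would be 0.\<close>
  have "emeasure hyp_measure P344 \<noteq> \<infinity>" using hi by (auto simp: top_unique)
  then have e: "emeasure hyp_measure P344 = ennreal (hyp_vol P344)"
    by (simp add: hyp_vol_def emeasure_eq_ennreal_measure)
  have "4 * catalan_approx \<le> hyp_vol P344"
    using lo unfolding e by (simp add: hyp_vol_def)
  then show "3.663862 < hyp_vol P344" using catalan_approx_bounds(1) by simp
  have "hyp_vol P344 \<le> 4 * (catalan_approx + 1 / 8 ^ 8)"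
    using hi catalan_approx_bounds(1) unfolding e by (subst (asm) ennreal_le_iff) auto
  also have "\<dots> < 4 * 0.9159657" using catalan_approx_bounds(2) by (intro mult_strict_left_mono) auto
  finally show "hyp_vol P344 < 3.6638628" by simp
qed

lemma cell_volume_pos: "0 < hyp_vol P344"
  by (rule less_trans[OF _ cell_volume_bounds(1)]) simp

lemma horoball_arrangement_weights:
  assumes "horoball_arrangement B"
  obtains w where "\<And>i. i < 6 \<Longrightarrow> 0 < w i" "\<And>i. i < 6 \<Longrightarrow> B i = horoball (ideal_vertex i) (w i)"
proof -
  have "\<forall>i. \<exists>w. i < 6 \<longrightarrow> 0 < w \<and> B i = horoball (ideal_vertex i) w"
    using assms is_horoball_iff[OF norm_vertex] unfolding horoball_arrangement_def by blast
  then show ?thesis using that by metis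
qed

lemma horoball_arrangement_horoballs:
  assumes "\<And>i. 0 < w i"
  shows "horoball_arrangement (\<lambda>i. horoball (ideal_vertex i) (w i))"
  using assms is_horoball_iff[OF norm_vertex] unfolding horoball_arrangement_def by blast

lemma all_less_6: "(\<forall>i<6. P i) \<longleftrightarrow> (\<forall>i\<in>{0, 1, 2, 3, 4, 5 :: nat}. P i)"
  unfolding less_6_iff by blast

text \<open>For distinct vertices this is the value \<open>((1 - u \<bullet> v) / 2)^2\<close> of
  the product of weights at tangency.\<close>

definition tangency_product :: "nat \<Rightarrow> nat \<Rightarrow> real" where
  "tangency_product i j = (if ideal_vertex i \<bullet> ideal_vertex j = 0 then 1 / 4 else 1)"

text \<open>Closed horoballs share a point from tangency onwards, whereas admissibility bounds the
  same product from above. This version serves the congruence invariant.\<close>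

lemma horoballs_meet_iff:
  assumes "i < 6" "j < 6" "i \<noteq> j" "0 < a" "0 < b"
  shows "horoball (ideal_vertex i) a \<inter> horoball (ideal_vertex j) b \<noteq> {} \<longleftrightarrow> tangency_product i j \<le> a * b"
proof (cases "ideal_vertex i \<bullet> ideal_vertex j = 0")
  case True
  note n = norm_vertex[OF assms(1)] norm_vertex[OF assms(2)]
  have "1 / 4 \<le> a * b" if "x \<in> horoball (ideal_vertex i) a" "x \<in> horoball (ideal_vertex j) b" for x
    using horoballs_orthogonal(1)[OF n True assms(4,5) _ that] by linarith
  then show ?thesis
    using tangent_point_orthogonal[OF n True assms(4), of b] True unfolding tangency_product_def by auto
next
  case False
  then have eq: "ideal_vertex j = - ideal_vertex i" using vertex_pair assms by blast
  note n = norm_vertex[OF assms(1)]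
  have "1 \<le> a * b" if "x \<in> horoball (ideal_vertex i) a" "x \<in> horoball (- ideal_vertex i) b" for x
    using horoballs_opposite(1)[OF n assms(4,5) _ that] by linarith
  then show ?thesis
    using tangent_point_opposite[OF n assms(4), of b] False unfolding tangency_product_def eq by auto
qed

lemma admissible_iff:
  assumes pos: "\<And>i. i < 6 \<Longrightarrow> 0 < w i" and B: "\<And>i. i < 6 \<Longrightarrow> B i = horoball (ideal_vertex i) (w i)"
  shows "admissible B \<longleftrightarrow> (\<forall>i<6. w i \<le> 2) \<and>
    (\<forall>i<6. \<forall>j<6. i \<noteq> j \<longrightarrow> w i * w j \<le> tangency_product i j)"
proof -
  have "horoball_arrangement B"
    using pos B is_horoball_iff[OF norm_vertex] unfolding horoball_arrangement_def by blast
  moreover have "interior (B i) \<inter> interior (B j) = {} \<longleftrightarrow>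
      w i * w j \<le> tangency_product i j"
    if "i < 6" "j < 6" "i \<noteq> j" for i j
  proof (cases "ideal_vertex i \<bullet> ideal_vertex j = 0")
    case True
    then show ?thesis
      using interiors_disjoint_orthogonal_iff[OF norm_vertex norm_vertex] pos B that
      by (simp add: tangency_product_def)
  next
    case False
    then have "ideal_vertex j = - ideal_vertex i" using vertex_pair that by blast
    then show ?thesis
      using interiors_disjoint_opposite_iff[OF norm_vertex] pos B that False
      by (simp add: tangency_product_def)
  qed
  moreover have "(\<forall>F. F facet_of octahedron \<and> ideal_vertex i \<notin> F \<longrightarrow> interior (B i) \<inter> F = {}) \<longleftrightarrow> w i \<le> 2"
    if "i < 6" for i
    unfolding B[OF that] by (rule face_condition_iff[OF that pos[OF that]])
  ultimately show ?thesis unfolding admissible_def by (smt (verit, best))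
qed

lemma packing_density_weights:
  assumes "\<And>i. i < 6 \<Longrightarrow> 0 < w i \<and> w i \<le> 2" "\<And>i. i < 6 \<Longrightarrow> B i = horoball (ideal_vertex i) (w i)"
  shows "packing_density B = (\<Sum>i<6. w i) / hyp_vol P344"
  unfolding packing_density_def using assms by (simp add: horoball_cell_volume)

section \<open>Maximizing the total weight\<close>

lemma weight_sum_le_3:
  fixes w :: "nat \<Rightarrow> real"
  assumes pos: "\<And>i. i < 6 \<Longrightarrow> 0 < w i" and le2: "\<forall>i<6. w i \<le> 2"
    and prod: "\<forall>i<6. \<forall>j<6. i \<noteq> j \<longrightarrow> w i * w j \<le> tangency_product i j"
  shows "(\<Sum>i<6. w i) \<le> 3"
proof -
  obtain i where i: "i < 6" and max: "\<And>j. j < 6 \<Longrightarrow> w j \<le> w i"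
  proof -
    have "Max (w ` {..<6}) \<in> w ` {..<6}" by (intro Max_in) (auto simp: lessThan_empty_iff)
    then obtain i where "i < 6" "w i = Max (w ` {..<6})" by auto
    then show ?thesis using that[of i] by simp
  qed
  define a where "a = w i"
  have a: "0 < a" "a \<le> 2" using pos le2 i by (auto simp: a_def)
  show ?thesis
  proof (cases "a \<le> 1 / 2")
    case True
    have "(\<Sum>i<6. w i) \<le> of_nat (card {..<6 :: nat}) * a" using max by (intro sum_bounded_above) (simp add: a_def)
    then show ?thesis using True by simp
  next
    case False
    obtain k where k: "k < 6" "k \<noteq> i" "ideal_vertex k = - ideal_vertex i"
      "\<And>j. j < 6 \<Longrightarrow> j \<noteq> i \<Longrightarrow> j \<noteq> k \<Longrightarrow> ideal_vertex i \<bullet> ideal_vertex j = 0"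
      using i by (rule opposite_vertex) blast
    have "w i * w k \<le> tangency_product i k"
      using prod i k(1,2) by auto
    then have "a * w k \<le> 1" by (auto simp: a_def tangency_product_def split: if_splits)
    then have wk: "w k \<le> 1 / a" using a by (simp add: field_simps)
    have wj: "w j \<le> 1 / (4 * a)" if "j \<in> {..<6} - {i, k}" for j
    proof -
      have "w i * w j \<le> tangency_product i j"
        using prod i that by auto
      then have "a * w j \<le> 1 / 4" using k(4)[of j] that by (simp add: a_def tangency_product_def)
      then show ?thesis using a by (simp add: field_simps)
    qed
    have "(\<Sum>i<6. w i) = w i + (w k + (\<Sum>j\<in>{..<6} - {i, k}. w j))"
      using i k by (subst sum.remove[of _ i], simp, simp, subst sum.remove[of _ k]) (auto simp: Diff_insert2[symmetric] insert_commute)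
    also have "(\<Sum>j\<in>{..<6} - {i, k}. w j) \<le> of_nat (card ({..<6} - {i, k})) * (1 / (4 * a))"
      by (rule sum_bounded_above) (rule wj)
    also have "card ({..<6} - {i, k}) = 4" using i k by (subst card_Diff_subset) auto
    \<comment> \<open>The four neighbours of the vertex of weight \<open>a\<close> contribute at
      most \<open>4 * (1 / (4 * a))\<close>.\<close>
    finally have le: "(\<Sum>i<6. w i) \<le> a + (w k + 1 / a)" by (simp add: a_def)
    show ?thesis
    proof (cases "a \<le> 1")
      case True
      \<comment> \<open>The antipode is bounded by maximality here, and
        \<open>2 * a + 1 / a \<le> 3\<close>, multiplied by \<open>a\<close>, factors with zeros 1/2
        and 1.\<close>
      have "0 \<le> (2 * a - 1) * (1 - a)" using True False by simp
      then have "2 * a * a + 1 \<le> 3 * a" by (simp add: algebra_simps)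
      then have "a + a + 1 / a \<le> 3" using a by (simp add: field_simps)
      moreover have "w k \<le> a" using max k by (simp add: a_def)
      ultimately show ?thesis using le by linarith
    next
      case False
      \<comment> \<open>Now the bound \<open>1 / a\<close> for the antipode is the better one, and
        \<open>a + 2 / a \<le> 3\<close> has the critical values 1 and 2.\<close>
      have "0 \<le> (a - 1) * (2 - a)" using a False by simp
      then have "a * a + 2 \<le> 3 * a" by (simp add: algebra_simps)
      then have "a + 1 / a + 1 / a \<le> 3" using a by (simp add: field_simps)
      then show ?thesis using le wk by linarith
    qed
  qed
qed

lemma optimally_dense_if_weight_sum_3:
  assumes adm: "admissible B"
    and "\<And>i. i < 6 \<Longrightarrow> 0 < w i" "\<And>i. i < 6 \<Longrightarrow> B i = horoball (ideal_vertex i) (w i)"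
    and "(\<Sum>i<6. w i) = 3"
  shows "optimally_dense B" "packing_density B = 3 / hyp_vol P344"
proof -
  have "packing_density B' = (\<Sum>i<6. w' i) / hyp_vol P344"
    if "admissible B'" "\<And>i. i < 6 \<Longrightarrow> 0 < w' i" "\<And>i. i < 6 \<Longrightarrow> B' i = horoball (ideal_vertex i) (w' i)"
    for B' w'
    using that admissible_iff[of w' B'] by (intro packing_density_weights) auto
  note dens = this
  show B: "packing_density B = 3 / hyp_vol P344" using dens[of B w] assms by simp
  have "packing_density B' \<le> 3 / hyp_vol P344" if B': "admissible B'" for B'
  proof -
    have "horoball_arrangement B'" using B' by (simp add: admissible_def)
    then obtain w' where w': "\<And>i. i < 6 \<Longrightarrow> 0 < w' i" "\<And>i. i < 6 \<Longrightarrow> B' i = horoball (ideal_vertex i) (w' i)"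
      by (rule horoball_arrangement_weights) blast
    have "(\<Sum>i<6. w' i) \<le> 3" using weight_sum_le_3[of w'] admissible_iff[of w' B'] B' w' by blast
    moreover have "packing_density B' = (\<Sum>i<6. w' i) / hyp_vol P344"
      by (rule dens[OF B']) (use w' in auto)
    ultimately show ?thesis using cell_volume_pos by (simp add: divide_right_mono)
  qed
  then show "optimally_dense B" using adm B by (simp add: optimally_dense_def)
qed

section \<open>Symmetries of the cell and the arrangement of equal horoballs\<close>

text \<open>The reflection in the plane orthogonal to \<open>n\<close>. For \<open>n = 0\<close> it
  is the identity, so equal vertices need no separate treatment.\<close>

definition reflection :: "real ^ 3 \<Rightarrow> real ^ 3 \<Rightarrow> real ^ 3" where
  "reflection n x = x - (2 * (x \<bullet> n) / (n \<bullet> n)) *\<^sub>R n"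

lemma inner_reflection: "reflection n x \<bullet> reflection n y = x \<bullet> y"
proof (cases "n = 0")
  case False
  then have "n \<bullet> n \<noteq> 0" by simp
  then show ?thesis
    by (simp add: reflection_def inner_diff_left inner_diff_right inner_commute field_simps)
qed (simp add: reflection_def)

lemma reflection_reflection: "reflection n (reflection n x) = x"
proof (cases "n = 0")
  case False
  then have "n \<bullet> n \<noteq> 0" by simp
  then show ?thesis
    by (simp add: reflection_def inner_diff_left diff_divide_distrib algebra_simps flip: scaleR_add_left)
qed (simp add: reflection_def)

lemma reflection_swaps:
  assumes "norm u = 1" "norm v = 1"
  shows "reflection (u - v) u = v"
proof (cases "u = v")
  case False
  have "u \<bullet> u = 1" "v \<bullet> v = 1" using assms by (simp_all add: dot_square_norm)
  then have eq: "2 * (u \<bullet> (u - v)) = (u - v) \<bullet> (u - v)"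
    by (simp add: inner_diff_left inner_diff_right inner_commute)
  have "2 * (u \<bullet> (u - v)) / ((u - v) \<bullet> (u - v)) = 1"
    unfolding eq using False by (intro divide_self) simp
  then show ?thesis unfolding reflection_def by (simp only: scaleR_one) simp
qed (simp add: reflection_def)

text \<open>For opposite vertices the reflection flips the sign of one coordinate; for orthogonal
  ones it exchanges two coordinates, possibly with signs. The sum of absolute values is unchanged in
  every case.\<close>

lemma reflection_octahedron:
  assumes "i < 6" "j < 6" "x \<in> octahedron"
  shows "reflection (ideal_vertex i - ideal_vertex j) x \<in> octahedron"
proof -
  have "\<forall>i\<in>{0, 1, 2, 3, 4, 5}. \<forall>j\<in>{0, 1, 2, 3, 4, 5}.
      reflection (ideal_vertex i - ideal_vertex j) x \<in> octahedron"
    using assms(3) by (simp add: octahedron_eq reflection_def vertex_simps inner_3 axis_def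
        diff_divide_distrib add_divide_distrib add.commute add.left_commute)
  then show ?thesis using assms(1,2) unfolding less_6_iff by blast
qed

lemma horoball_subset_hyp_space: "horoball u w \<subseteq> hyp_space"
  by (auto simp: horoball_def)

text \<open>Distances and horoballs are expressed by inner products alone, so a linear isometry
  carries the horoball at \<open>u\<close> to the horoball of the same weight at the image of
  \<open>u\<close>. The reflection exchanging the two vertices is such a map.\<close>

lemma same_type_horoballs:
  assumes i: "i < 6" and j: "j < 6"
  shows "same_type (horoball (ideal_vertex i) w) (horoball (ideal_vertex j) w)"
proof -
  define g where "g = reflection (ideal_vertex i - ideal_vertex j)"
  have inner: "g x \<bullet> g y = x \<bullet> y" and gg: "g (g x) = x" for x y
    by (simp_all add: g_def inner_reflection reflection_reflection)
  have hyp: "g x \<in> hyp_space" if "x \<in> hyp_space" for x using that by (simp add: hyp_space_iff inner)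
  have "bij_betw g hyp_space hyp_space"
    by (rule bij_betw_byWitness[of _ g]) (auto simp: gg hyp)
  then have "hyp_isometry g" by (simp add: hyp_isometry_def hyp_dist_def inner)
  moreover have "g ` P344 = P344"
  proof -
    have "g x \<in> P344" if "x \<in> P344" for x
      using that hyp reflection_octahedron[OF i j] by (auto simp: P344_def g_def)
    then show ?thesis using gg by (metis image_eqI image_subsetI subsetI subset_antisym)
  qed
  moreover have "g ` horoball (ideal_vertex i) w = horoball (ideal_vertex j) w"
  proof -
    have gi: "g (ideal_vertex i) = ideal_vertex j"
      unfolding g_def using norm_vertex[OF i] norm_vertex[OF j] by (rule reflection_swaps)
    have gj: "g (ideal_vertex j) = ideal_vertex i" using gg[of "ideal_vertex i"] gi by simp
    have img: "g x \<in> horoball (g u) w" if "x \<in> horoball u w" for x u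
      using that by (simp add: horoball_def hyp inner)
    show ?thesis
    proof
      show "g ` horoball (ideal_vertex i) w \<subseteq> horoball (ideal_vertex j) w" using img gi by force
      show "horoball (ideal_vertex j) w \<subseteq> g ` horoball (ideal_vertex i) w"
      proof
        fix x assume "x \<in> horoball (ideal_vertex j) w"
        then have "g x \<in> horoball (ideal_vertex i) w" using img gj by force
        then show "x \<in> g ` horoball (ideal_vertex i) w" using gg[of x] by force
      qed
    qed
  qed
  ultimately show ?thesis unfolding same_type_def cell_symmetry_def by blast
qed

text \<open>A segment between opposite vertices contains the center, which is also interior to the
  segment from \<open>v\<close> to \<open>- v\<close> for an orthogonal vertex \<open>v\<close>. If
  the first segment were a face, it would have to contain \<open>v\<close>, which is off its
  line.\<close>

lemma adjacent_orthogonal: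
  assumes "adjacent i j"
  shows "ideal_vertex i \<bullet> ideal_vertex j = 0"
proof (rule ccontr)
  define u where "u = ideal_vertex i"
  assume "\<not> ?thesis"
  then have ij: "i < 6" "j < 6" "ideal_vertex j = - u" "u = ideal_vertex i"
    using assms vertex_pair[of i j] by (auto simp: adjacent_def u_def)
  have face: "closed_segment u (- u) face_of octahedron"
    using assms ij by (simp add: adjacent_def edge_of_def)
  obtain k where k: "k < 6" "ideal_vertex i \<bullet> ideal_vertex k = 0"
  proof -
    have "\<exists>k\<in>{0, 1 :: nat}. ideal_vertex i \<bullet> ideal_vertex k = 0"
      using ij(1) unfolding less_6_iff by (elim insertE emptyE) (simp_all add: vertex_simps inner_axis_axis)
    then obtain k :: nat where "k \<in> {0, 1}" "ideal_vertex i \<bullet> ideal_vertex k = 0" by blast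
    then show ?thesis using that[of k] by auto
  qed
  obtain k' where k': "k' < 6" "ideal_vertex k' = - ideal_vertex k"
    using k(1) by (rule opposite_vertex) blast
  define v where "v = ideal_vertex k"
  have nv: "norm v = 1" using k by (simp add: v_def norm_vertex)
  then have "v \<bullet> v = 1" by (simp add: dot_square_norm)
  then have "v \<noteq> - v"
    using inner_minus_right[of v v] by (metis equation_minus_iff neg_equal_zero zero_neq_one)
  have "v \<in> octahedron" "- v \<in> octahedron"
    using k k' by (auto simp: octahedron_def v_def intro!: hull_inc)
       (metis image_eqI lessThan_iff)
  moreover have "0 \<in> open_segment v (- v)"
    using \<open>v \<noteq> - v\<close> by (auto simp: in_segment intro!: exI[of _ "1 / 2"])
  moreover have "0 \<in> closed_segment u (- u)"
    by (auto simp: in_segment intro!: exI[of _ "1 / 2"])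
  ultimately have "v \<in> closed_segment u (- u)" using face by (blast dest: face_ofD)
  then obtain t where v: "v = (1 - t) *\<^sub>R u + t *\<^sub>R (- u)" by (auto simp: in_segment)
  have "v \<bullet> u = 0" using k ij by (simp add: v_def inner_commute)
  then have "v \<bullet> ((1 - t) *\<^sub>R u + t *\<^sub>R (- u)) = 0" by (simp add: inner_diff_right)
  then have "v \<bullet> v = 0" unfolding v[symmetric] .
  then show False using nv by simp
qed

lemma arrangement1_horoballs:
  "arrangement1 (\<lambda>i. horoball (ideal_vertex i) (1 / 2))"
  unfolding arrangement1_def
proof (intro conjI allI impI)
  show "horoball_arrangement (\<lambda>i. horoball (ideal_vertex i) (1 / 2))"
    by (rule horoball_arrangement_horoballs) simp
next
  fix i j :: nat assume "i < 6" "j < 6"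
  then show "same_type (horoball (ideal_vertex i) (1 / 2)) (horoball (ideal_vertex j) (1 / 2))"
    by (rule same_type_horoballs)
next
  fix i j assume adj: "adjacent i j"
  define u v p where "u = ideal_vertex i" and "v = ideal_vertex j" and "p = (1 / 2) *\<^sub>R (u + v)"
  have n: "norm u = 1" "norm v = 1" using adj by (auto simp: adjacent_def norm_vertex u_def v_def)
  have uv: "u \<bullet> v = 0" using adjacent_orthogonal[OF adj] by (simp add: u_def v_def)
  have uu: "u \<bullet> u = 1" "v \<bullet> v = 1" "v \<bullet> u = 0"
    using n uv by (auto simp: dot_square_norm inner_commute)
  \<comment> \<open>For equal weights the tangent point is the Euclidean midpoint of the
    edge.\<close>
  have "tangent_at (horoball u (1 / 2)) (horoball v (1 / 2)) p"
    using tangent_at_orthogonal[OF n uv, of "1 / 2" "1 / 2"] by (simp add: p_def)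
  moreover have "edge_midpoint i j p"
    unfolding edge_midpoint_def perp_foot_def u_def[symmetric] v_def[symmetric] cell_center_def
  proof (intro conjI ballI IntI)
    show "p \<in> closed_segment u v"
      by (auto simp: in_segment p_def scaleR_add_right intro!: exI[of _ "1 / 2"])
    show "p \<in> hyp_space" using uu uv by (simp add: hyp_space_iff p_def inner_add_left inner_add_right)
    fix q assume "q \<in> closed_segment u v"
    then obtain t where q: "q = (1 - t) *\<^sub>R u + t *\<^sub>R v" by (auto simp: in_segment)
    have "p \<bullet> (q - p) = 0"
      unfolding q p_def using uu uv by (simp add: inner_add_left inner_add_right inner_diff_right algebra_simps)
    \<comment> \<open>From the center 0 the direction is \<open>p\<close> itself, so both terms of
      the metric contain the factor \<open>p \<bullet> (q - p)\<close>.\<close>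
    then show "hyp_metric p (p - 0) (q - p) = 0" by (simp add: hyp_metric_def)
  qed
  ultimately show "\<exists>p. edge_midpoint i j p \<and>
      tangent_at (horoball (ideal_vertex i) (1 / 2)) (horoball (ideal_vertex j) (1 / 2)) p"
    by (auto simp: u_def v_def)
qed

section \<open>The two arrangements with unequal horoballs\<close>

text \<open>Tangency of opposite horoballs at the center means weight 1 for both; the neighbours
  then need product 1/4.\<close>

definition weights2 :: "nat \<Rightarrow> real" where
  "weights2 i = (if i = 3 \<or> i = 5 then 1 else 1 / 4)"

text \<open>Weight 2 is the critical value for touching the far facets. Tangency to that horoball
  gives 1/2 at the antipode (product 1) and 1/8 at the neighbours (product 1/4).\<close>

definition weights3 :: "nat \<Rightarrow> real" where
  "weights3 i = (if i = 3 then 2 else if i = 5 then 1 / 2 else 1 / 8)"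

lemma tangent_horoballs:
  assumes "i < 6" "j < 6" "0 < a" "0 < b"
    and "ideal_vertex i \<bullet> ideal_vertex j = 0 \<and> a * b = 1 / 4 \<or> ideal_vertex j = - ideal_vertex i \<and> a * b = 1"
  shows "tangent (horoball (ideal_vertex i) a) (horoball (ideal_vertex j) b)"
  using assms(5)
proof
  assume *: "ideal_vertex i \<bullet> ideal_vertex j = 0 \<and> a * b = 1 / 4"
  show ?thesis unfolding tangent_def
    by (rule exI, rule tangent_at_orthogonal) (use * assms norm_vertex in auto)
next
  assume "ideal_vertex j = - ideal_vertex i \<and> a * b = 1"
  then show ?thesis unfolding tangent_def
    using tangent_at_opposite[OF norm_vertex[OF assms(1)], of a b] assms(3,4) by auto
qed

lemma arrangement2_horoballs: "arrangement2 (\<lambda>i. horoball (ideal_vertex i) (weights2 i))"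
  unfolding arrangement2_def
proof (intro conjI ballI)
  show "horoball_arrangement (\<lambda>i. horoball (ideal_vertex i) (weights2 i))"
    by (rule horoball_arrangement_horoballs) (simp add: weights2_def)
  show "tangent_at (horoball (ideal_vertex 3) (weights2 3)) (horoball (ideal_vertex 5) (weights2 5)) cell_center"
    using tangent_at_opposite[of "axis 3 1" 1 1] by (simp add: weights2_def vertex_simps cell_center_def)
next
  fix i j :: nat assume ij: "i \<in> {3, 5}" "j \<in> {0, 1, 2, 4}"
  then have "i < 6" "j < 6" by auto
  have vol: "hyp_vol (horoball (ideal_vertex k) (weights2 k) \<inter> P344) = weights2 k" if "k < 6" for k
    using that by (intro horoball_cell_volume) (auto simp: weights2_def)
  show "hyp_vol (horoball (ideal_vertex j) (weights2 j) \<inter> P344) <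
      hyp_vol (horoball (ideal_vertex i) (weights2 i) \<inter> P344)"
    unfolding vol[OF \<open>i < 6\<close>] vol[OF \<open>j < 6\<close>] using ij by (auto simp: weights2_def)
next
  fix j :: nat assume j: "j \<in> {0, 1, 2, 4}"
  show "tangent (horoball (ideal_vertex j) (weights2 j)) (horoball (ideal_vertex 3) (weights2 3))"
    using j by (intro tangent_horoballs) (auto simp: weights2_def vertex_simps inner_axis_axis)
  show "tangent (horoball (ideal_vertex j) (weights2 j)) (horoball (ideal_vertex 5) (weights2 5))"
    using j by (intro tangent_horoballs) (auto simp: weights2_def vertex_simps inner_axis_axis)
qed

lemma arrangement3_horoballs: "arrangement3 (\<lambda>i. horoball (ideal_vertex i) (weights3 i))"
  unfolding arrangement3_def
proof (intro conjI ballI allI impI)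
  show "horoball_arrangement (\<lambda>i. horoball (ideal_vertex i) (weights3 i))"
    by (rule horoball_arrangement_horoballs) (simp add: weights3_def)
next
  fix j :: nat assume "j \<in> {0, 1, 2, 4, 5}"
  then show "tangent (horoball (ideal_vertex j) (weights3 j)) (horoball (ideal_vertex 3) (weights3 3))"
    by (intro tangent_horoballs) (auto simp: weights3_def vertex_simps inner_axis_axis)
next
  fix F assume F: "F facet_of octahedron \<and> ideal_vertex 3 \<notin> F"
  obtain n where n: "face_normal n" "F = octahedron \<inter> {x. n \<bullet> x = 1}" "n \<bullet> ideal_vertex 3 = -1"
    by (rule facet_avoiding_vertex[of 3 F]) (use F in simp_all)
  then have "n \<noteq> 0" by auto
  define B where "B = horoball (ideal_vertex 3) 2"
  have "interior B \<subseteq> interior {x. n \<bullet> x \<le> 1}"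
    unfolding B_def using n by (intro interior_mono horoball_face_halfspace) auto
  then have int: "interior B \<subseteq> {x. n \<bullet> x < 1}" using \<open>n \<noteq> 0\<close> by simp
  have "affine hull F \<subseteq> {x. n \<bullet> x = 1}"
    using n by (intro hull_minimal affine_hyperplane) auto
  then have "interior B \<inter> affine hull F = {}" using int by fastforce
  moreover have "B \<inter> F \<noteq> {}"
  proof -
    have nk: "n $ k \<in> {1, -1}" for k using n by (simp add: face_normal_def)
    \<comment> \<open>The contact point is the midpoint of the edge that the facet shares with the
      plane of the equator; there the inequality of weight 2 is an equality.\<close>
    define x :: "real ^ 3" where "x = vector [n $ 1 / 2, n $ 2 / 2, 0]"
    have x: "x $ 1 = n $ 1 / 2" "x $ 2 = n $ 2 / 2" "x $ 3 = 0" by (simp_all add: x_def)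
    have "n $ k * n $ k = 1" for k using nk[of k] by auto
    then have "x \<bullet> x = 1 / 2" "n \<bullet> x = 1" by (simp_all add: inner_3 x)
    moreover have "x \<bullet> ideal_vertex 3 = 0" by (simp add: vertex_simps inner_axis x)
    moreover have "x \<in> octahedron" using nk[of 1] nk[of 2] by (auto simp: octahedron_eq x)
    ultimately have "x \<in> B \<inter> F" using n by (simp add: B_def horoball_def hyp_space_iff)
    then show ?thesis by blast
  qed
  ultimately show "tangent_to_face (horoball (ideal_vertex 3) (weights3 3)) F"
    by (simp add: tangent_to_face_def B_def weights3_def)
qed

section \<open>Non-congruence of the three arrangements\<close>

text \<open>The number of horoballs that meet all the others is an invariant of congruence: it is 0, 2
  and 1 for the three arrangements.\<close>

definition meets_all :: "(nat \<Rightarrow> (real ^ 3) set) \<Rightarrow> nat \<Rightarrow> bool" where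
  "meets_all B i \<longleftrightarrow> i < 6 \<and> (\<forall>j<6. B i \<inter> B j \<noteq> {})"

text \<open>Congruence compares the families only as sets of horoballs, so matching indices must be
  chosen in both directions. Whether two horoballs meet is preserved because \<open>g\<close> is
  injective on the whole space.\<close>

lemma congruent_meets_all:
  assumes sub: "\<And>i. i < 6 \<Longrightarrow> B i \<subseteq> hyp_space" and inj: "inj_on g hyp_space"
    and img: "(\<lambda>i. g ` B i) ` {..<6} = B' ` {..<6}"
  shows "meets_all B i \<Longrightarrow> \<exists>i'. meets_all B' i' \<and> B' i' = g ` B i"
    and "meets_all B' i' \<Longrightarrow> \<exists>i. meets_all B i"
proof -
  have meet: "g ` B i \<inter> g ` B j \<noteq> {} \<longleftrightarrow> B i \<inter> B j \<noteq> {}" if "i < 6" "j < 6" for i j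
    using inj_on_image_Int[OF inj sub sub, OF that] by auto
  have to: "\<exists>i'<6. B' i' = g ` B i" if "i < 6" for i
  proof -
    have "g ` B i \<in> B' ` {..<6}" unfolding img[symmetric] using that by blast
    then show ?thesis by auto
  qed
  have fro: "\<exists>i<6. B' i' = g ` B i" if "i' < 6" for i'
  proof -
    have "B' i' \<in> (\<lambda>i. g ` B i) ` {..<6}" unfolding img using that by blast
    then show ?thesis by auto
  qed
  show "\<exists>i'. meets_all B' i' \<and> B' i' = g ` B i" if "meets_all B i"
  proof -
    have i: "i < 6" "\<And>j. j < 6 \<Longrightarrow> B i \<inter> B j \<noteq> {}" using that unfolding meets_all_def by blast+
    obtain i' where i': "i' < 6" "B' i' = g ` B i" using to i by blast
    have "B' i' \<inter> B' j' \<noteq> {}" if j': "j' < 6" for j'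
    proof -
      obtain j where j: "j < 6" "B' j' = g ` B j" using fro[OF j'] by blast
      show ?thesis unfolding i'(2) j(2) meet[OF i(1) j(1)] by (rule i(2)[OF j(1)])
    qed
    then show ?thesis using i' unfolding meets_all_def by blast
  qed
  show "\<exists>i. meets_all B i" if "meets_all B' i'"
  proof -
    have i': "i' < 6" "\<And>j. j < 6 \<Longrightarrow> B' i' \<inter> B' j \<noteq> {}" using that unfolding meets_all_def by blast+
    obtain i where i: "i < 6" "B' i' = g ` B i" using fro i' by blast
    have "B i \<inter> B j \<noteq> {}" if j: "j < 6" for j
    proof -
      obtain j' where j': "j' < 6" "B' j' = g ` B j" using to[OF j] by blast
      show ?thesis using i'(2)[OF j'(1)] unfolding i(2) j'(2) meet[OF i(1) j] .
    qed
    then show ?thesis using i unfolding meets_all_def by blast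
  qed
qed

lemma meets_all_iff:
  assumes pos: "\<And>i. 0 < w i"
  shows "meets_all (\<lambda>i. horoball (ideal_vertex i) (w i)) i \<longleftrightarrow>
    i < 6 \<and> (\<forall>j<6. i \<noteq> j \<longrightarrow> tangency_product i j \<le> w i * w j)"
proof -
  have nonempty: "horoball (ideal_vertex i) (w i) \<noteq> {}" if "i < 6"
  proof -
    \<comment> \<open>An auxiliary opposite horoball of weight \<open>1 / w i\<close> supplies a
      point of the given one.\<close>
    have "1 \<le> w i * (1 / w i)" using pos[of i] by simp
    from tangent_point_opposite[OF norm_vertex[OF that] pos this] show ?thesis by blast
  qed
  have "horoball (ideal_vertex i) (w i) \<inter> horoball (ideal_vertex j) (w j) \<noteq> {} \<longleftrightarrow>
      (i \<noteq> j \<longrightarrow> tangency_product i j \<le> w i * w j)" if "i < 6" "j < 6" for j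
  proof (cases "i = j")
    case True
    then show ?thesis using nonempty that by simp
  next
    case False
    then show ?thesis using horoballs_meet_iff[OF that False pos pos] by blast
  qed
  then show ?thesis unfolding meets_all_def by blast
qed

lemma not_meets_all_1: "\<not> meets_all (\<lambda>i. horoball (ideal_vertex i) (1 / 2)) i"
proof
  assume "meets_all (\<lambda>i. horoball (ideal_vertex i) (1 / 2)) i"
  then have i: "i < 6" and *: "\<And>j. j < 6 \<Longrightarrow> i \<noteq> j \<Longrightarrow> tangency_product i j \<le> 1 / 4"
    using meets_all_iff[of "\<lambda>_. 1 / 2" i] by simp_all
  obtain k where k: "k < 6" "k \<noteq> i" "ideal_vertex k = - ideal_vertex i"
    using i by (rule opposite_vertex) blast
  have "ideal_vertex i \<bullet> ideal_vertex k = -1"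
    unfolding k(3) inner_minus_right dot_square_norm norm_vertex[OF i] by simp
  then have "tangency_product i k = 1" by (simp add: tangency_product_def)
  then show False using *[of k] k by simp
qed

lemma meets_all_2: "i \<in> {3, 5} \<Longrightarrow> meets_all (\<lambda>i. horoball (ideal_vertex i) (weights2 i)) i"
  by (subst meets_all_iff) (auto simp: weights2_def all_less_6 tangency_product_def vertex_simps inner_axis_axis)

lemma meets_all_3_iff: "meets_all (\<lambda>i. horoball (ideal_vertex i) (weights3 i)) i \<longleftrightarrow> i = 3"
proof -
  define P where "P i j \<longleftrightarrow> tangency_product i j \<le> weights3 i * weights3 j" for i j
  \<comment> \<open>Each index other than 3 gets a partner that it misses: the antipode for 0, 1, 2,
    4, and the neighbour 0 for 5, whose antipode is the large horoball that it touches.\<close>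
  have "\<not> P 0 2" "\<not> P 1 4" "\<not> P 2 0" "\<not> P 4 1" "\<not> P 5 0"
    "P 3 0" "P 3 1" "P 3 2" "P 3 4" "P 3 5"
    unfolding P_def tangency_product_def weights3_def by (simp_all add: vertex_simps inner_axis_axis)
  note P = this
  have "i = 3" if i: "i < 6" and all: "\<forall>j<6. i \<noteq> j \<longrightarrow> P i j"
  proof -
    have "i \<noteq> j \<longrightarrow> P i j" if "j < 6" for j using all that by blast
    from this[of 0] this[of 1] this[of 2] this[of 4] show ?thesis
      using i P unfolding less_6_iff by (elim insertE emptyE) simp_all
  qed
  moreover have "\<forall>j<6. 3 \<noteq> j \<longrightarrow> P 3 j" unfolding all_less_6 using P by simp
  ultimately have "i < 6 \<and> (\<forall>j<6. i \<noteq> j \<longrightarrow> P i j) \<longleftrightarrow> i = 3" by auto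
  then show ?thesis
    unfolding P_def by (subst meets_all_iff) (simp_all add: weights3_def)
qed

lemma not_congruent:
  defines "B1 \<equiv> \<lambda>i. horoball (ideal_vertex i) (1 / 2)"
    and "B2 \<equiv> \<lambda>i. horoball (ideal_vertex i) (weights2 i)"
    and "B3 \<equiv> \<lambda>i. horoball (ideal_vertex i) (weights3 i)"
  shows "\<not> congruent_arrangements B1 B2" "\<not> congruent_arrangements B1 B3"
    "\<not> congruent_arrangements B2 B3"
proof -
  have sub: "B1 i \<subseteq> hyp_space" "B2 i \<subseteq> hyp_space" for i
    by (simp_all add: B1_def B2_def horoball_subset_hyp_space)
  have inj: "inj_on g hyp_space" if "cell_symmetry g" for g
    using that by (auto simp: cell_symmetry_def hyp_isometry_def bij_betw_def)
  have m: "\<not> meets_all B1 i" "meets_all B2 3" "meets_all B2 5" "meets_all B3 i \<longleftrightarrow> i = 3" for i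
    using not_meets_all_1 meets_all_2[of 3] meets_all_2[of 5] meets_all_3_iff
    by (simp_all add: B1_def B2_def B3_def)
  have "\<not> congruent_arrangements B1 B'" if "meets_all B' i'" for B' i'
  proof
    assume "congruent_arrangements B1 B'"
    then obtain g where g: "cell_symmetry g" "(\<lambda>i. g ` B1 i) ` {..<6} = B' ` {..<6}"
      unfolding congruent_arrangements_def by blast
    show False using congruent_meets_all(2)[OF sub(1) inj[OF g(1)] g(2) that] m(1) by blast
  qed
  from this[OF m(2)] this[of B3 3] m(4)
  show "\<not> congruent_arrangements B1 B2" "\<not> congruent_arrangements B1 B3" by simp_all
  show "\<not> congruent_arrangements B2 B3"
  proof
    assume "congruent_arrangements B2 B3"
    then obtain g where g: "cell_symmetry g" "(\<lambda>i. g ` B2 i) ` {..<6} = B3 ` {..<6}"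
      unfolding congruent_arrangements_def by blast
    \<comment> \<open>Every horoball that meets all the others must go to the only such horoball of
      the third arrangement, so the two large horoballs would have the same image.\<close>
    have "g ` B2 i = B3 3" if all: "meets_all B2 i" for i
    proof -
      obtain i' where "meets_all B3 i'" "B3 i' = g ` B2 i"
        using congruent_meets_all(1)[OF sub(2) inj[OF g(1)] g(2) all] by blast
      then show ?thesis using m(4) by simp
    qed
    from this[OF m(2)] this[OF m(3)] have "g ` B2 3 = g ` B2 5" by simp
    then have "B2 3 = B2 5" by (simp only: inj_on_image_eq_iff[OF inj[OF g(1)] sub(2) sub(2)])
    \<comment> \<open>If they coincided, both would be the single point 0. As \<open>B2 0\<close>
      meets \<open>B2 3\<close>, it would contain 0, but it has weight 1/4 and the center needs
      weight at least 1.\<close>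
    moreover have "B2 3 \<inter> B2 5 = {0}"
      using arrangement2_horoballs by (simp add: arrangement2_def tangent_at_def cell_center_def B2_def)
    ultimately have "B2 3 = {0}" by simp
    moreover have "B2 3 \<inter> B2 0 \<noteq> {}" using m(2) by (auto simp: meets_all_def)
    ultimately have "0 \<in> B2 0" by auto
    then show False by (simp add: B2_def horoball_def weights2_def)
  qed
qed

theorem theorem4p11:
  shows "\<exists>B1 B2 B3.
    arrangement1 B1 \<and> arrangement2 B2 \<and> arrangement3 B3 \<and>
    optimally_dense B1 \<and> optimally_dense B2 \<and> optimally_dense B3 \<and>
    \<not> congruent_arrangements B1 B2 \<and> \<not> congruent_arrangements B1 B3 \<and>
    \<not> congruent_arrangements B2 B3 \<and>
    packing_density B1 = packing_density B2 \<and> packing_density B2 = packing_density B3 \<and>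
    \<bar>packing_density B1 - 0.818808\<bar> < 0.0000005"
proof -
  let ?B = "\<lambda>w i. horoball (ideal_vertex i) (w i)"
  have 6: "{..<6 :: nat} = {0, 1, 2, 3, 4, 5}" by auto
  have opt: "optimally_dense (?B w) \<and> packing_density (?B w) = 3 / hyp_vol P344"
    if "w \<in> {\<lambda>i. 1 / 2, weights2, weights3}" for w
  proof -
    have pos: "0 < w i" for i using that by (auto simp: weights2_def weights3_def)
    \<comment> \<open>The totals are \<open>6 * (1/2)\<close>, \<open>2 * 1 + 4 * (1/4)\<close> and
      \<open>2 + 1/2 + 4 * (1/8)\<close>.\<close>
    have sum: "(\<Sum>i<6. w i) = 3" using that by (auto simp: 6 weights2_def weights3_def)
    have "\<forall>i<6. \<forall>j<6. i \<noteq> j \<longrightarrow> w i * w j \<le> tangency_product i j"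
      using that unfolding all_less_6
      by (auto simp: tangency_product_def weights2_def weights3_def vertex_simps inner_axis_axis)
    moreover have "\<forall>i<6. w i \<le> 2" using that by (auto simp: weights2_def weights3_def)
    ultimately have "admissible (?B w)"
      using admissible_iff[of w "?B w"] pos by blast
    then show ?thesis using optimally_dense_if_weight_sum_3[of "?B w" w] pos sum by blast
  qed
  have dens: "\<bar>3 / hyp_vol P344 - 0.818808\<bar> < 0.0000005"
  proof -
    define d where "d = 3 / hyp_vol P344"
    have "d < 0.8188085" "0.8188075 < d"
      unfolding d_def using cell_volume_bounds cell_volume_pos
      by (simp_all add: pos_divide_less_eq pos_less_divide_eq)
    then show ?thesis unfolding d_def[symmetric] by (subst abs_less_iff) simp
  qed
  note opt1 = opt[of "\<lambda>i. 1 / 2", simplified] and opt2 = opt[of weights2, simplified]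
    and opt3 = opt[of weights3, simplified]
  show ?thesis
  proof (intro exI conjI)
    show "arrangement1 (\<lambda>i. horoball (ideal_vertex i) (1 / 2))" by (rule arrangement1_horoballs)
    show "arrangement2 (\<lambda>i. horoball (ideal_vertex i) (weights2 i))" by (rule arrangement2_horoballs)
    show "arrangement3 (\<lambda>i. horoball (ideal_vertex i) (weights3 i))" by (rule arrangement3_horoballs)
  qed (simp_all only: opt1 opt2 opt3 not_congruent dens not_False_eq_True)
qed

end
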